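(* Let $p\in(0,1)$, let $n\ge2$ be an integer, and let $M=M^{(p,n)}$ be the limit set of Mandelbrot's fractal percolation process with parameters $p,n$. Then almost surely $$\dim_{tH}M<\dim_H M\quad\text{or}\quad M=\emptyset.$$
   Context: Fractal percolation: let $p\in(0,1)$ and $n\ge2$ an integer. Set $M_0=[0,1]^2$. Divide the unit square into $n^2$ equal closed sub-squares of side-length $1/n$ in the natural way; keep each sub-square independently with probability $p$ (and erase it with probability $1-p$), and let $M_1$ be the union of the kept sub-squares. Then each square in $M_1$ is divided into $n^2$ closed squares of side-length $1/n^2$, each kept independently (also of earlier choices) with probability $p$, and so on. After $k$ steps $M_k=M_k^{(p,n)}$ is the union of the kept level-$k$ squares of side-length $1/n^k$. The limit set is $M=M^{(p,n)}=\bigcap_{k=1}^\infty M_k$. $\dim_H$ denotes Hausdorff dimension, with the convention $\dim_H\emptyset=-1$. The topological Hausdorff dimension is defined by $\dim_{tH}\emptyset=-1$ and, for a non-empty metric space $X$, $\dim_{tH}X=\inf\{d: X \text{ has a basis } \mathcal U \text{ of open sets such that } \dim_H\partial U\le d-1 \text{ for every } U\in\mathcal U\}$ (where $d=\infty$ is allowed, with $\infty-1=\infty$). *)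

theory Defs
  imports "HOL-Probability.Probability"
begin

section \<open>Hausdorff measure and Hausdorff dimension\<close>

text \<open>
  The $s$-th power of the diameter, with $(\mathrm{diam}\,\emptyset)^s = 0$ and $0^0 = 1$ for
  nonempty sets. The case distinction is needed because \<^term>\<open>0 powr 0 = (0::real)\<close>.
\<close>
definition diam_pow :: "real \<Rightarrow> 'a::metric_space set \<Rightarrow> ennreal" where
  "diam_pow s U =
     (if U = {} then 0 else if s = 0 then 1 else ennreal (diameter U powr s))"

text \<open>
  \<^const>\<open>diameter\<close> is real-valued and meaningful for bounded sets only, so boundedness is
  required separately. Finite covers are included, as the \<open>U i\<close> may be empty.
\<close>
definition hausdorff_premeasure :: "real \<Rightarrow> real \<Rightarrow> 'a::metric_space set \<Rightarrow> ennreal" where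
  "hausdorff_premeasure s \<delta> E =
     Inf {(\<Sum>i. diam_pow s (U i)) | U :: nat \<Rightarrow> 'a set.
            E \<subseteq> (\<Union>i. U i) \<and> (\<forall>i. bounded (U i) \<and> diameter (U i) \<le> \<delta>)}"

text \<open>The supremum over \<open>\<delta> > 0\<close> is the limit for \<open>\<delta>\<close> tending to \<open>0\<close>.\<close>
definition hausdorff_measure :: "real \<Rightarrow> 'a::metric_space set \<Rightarrow> ennreal" where
  "hausdorff_measure s E = (SUP \<delta>\<in>{0<..}. hausdorff_premeasure s \<delta> E)"

text \<open>The infimum is taken in \<^typ>\<open>ereal\<close>, so it is \<open>\<infinity>\<close> if no such \<open>s\<close> exists.\<close>
definition hausdorff_dim :: "'a::metric_space set \<Rightarrow> ereal" where
  "hausdorff_dim E =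
     (if E = {} then -1 else Inf (ereal ` {s. 0 \<le> s \<and> hausdorff_measure s E = 0}))"

section \<open>Topological Hausdorff dimension\<close>

text \<open>The analogue of \<^const>\<open>topological_basis\<close> for an explicit topology.\<close>
definition topology_basis :: "'a topology \<Rightarrow> 'a set set \<Rightarrow> bool" where
  "topology_basis T B \<longleftrightarrow>
     (\<forall>U\<in>B. openin T U) \<and> (\<forall>V. openin T V \<longrightarrow> (\<exists>B'\<subseteq>B. \<Union>B' = V))"

text \<open>
  \<open>X\<close> is regarded as a metric space in its own right: open sets and boundaries are
  relative to \<open>X\<close>. The value \<open>d = \<infinity>\<close> is allowed, and \<open>\<infinity> - 1 = \<infinity>\<close> in \<^typ>\<open>ereal\<close>.
\<close>
definition topological_hausdorff_dim :: "'a::metric_space set \<Rightarrow> ereal" where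
  "topological_hausdorff_dim X =
     (if X = {} then -1
      else Inf {d :: ereal. \<exists>B. topology_basis (top_of_set X) B \<and>
                  (\<forall>U\<in>B. hausdorff_dim (top_of_set X frontier_of U) \<le> d - 1)})"

section \<open>Fractal percolation\<close>

definition grid_square :: "nat \<Rightarrow> nat \<Rightarrow> nat \<times> nat \<Rightarrow> (real \<times> real) set" where
  "grid_square n k = (\<lambda>(i, j).
     {real i / real (n ^ k) .. real (i + 1) / real (n ^ k)} \<times>
     {real j / real (n ^ k) .. real (j + 1) / real (n ^ k)})"

text \<open>
  The triple \<open>(k, i, j)\<close> stands for the level-\<open>k\<close> square \<open>grid_square n k (i, j)\<close>, for which
  one random keep/erase decision is made.
\<close>
definition percolation_index :: "nat \<Rightarrow> (nat \<times> nat \<times> nat) set" where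
  "percolation_index n = {(k, i, j). 1 \<le> k \<and> i < n ^ k \<and> j < n ^ k}"

text \<open>
  Positions of the surviving level-\<open>k\<close> squares for a given outcome \<open>keep\<close> of the decisions.
  The level-\<open>(k+1)\<close> square \<open>(i, j)\<close> lies in the level-\<open>k\<close> square \<open>(i div n, j div n)\<close>; decisions
  for subsquares of erased squares play no role.
\<close>
primrec kept_squares :: "nat \<Rightarrow> (nat \<times> nat \<times> nat \<Rightarrow> bool) \<Rightarrow> nat \<Rightarrow> (nat \<times> nat) set" where
  "kept_squares n keep 0 = {(0, 0)}"
| "kept_squares n keep (Suc k) =
     {(i, j). (i div n, j div n) \<in> kept_squares n keep k \<and> keep (Suc k, i, j)}"

definition percolation_step :: "nat \<Rightarrow> (nat \<times> nat \<times> nat \<Rightarrow> bool) \<Rightarrow> nat \<Rightarrow> (real \<times> real) set" where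
  "percolation_step n keep k = (\<Union>c\<in>kept_squares n keep k. grid_square n k c)"

definition percolation_limit :: "nat \<Rightarrow> (nat \<times> nat \<times> nat \<Rightarrow> bool) \<Rightarrow> (real \<times> real) set" where
  "percolation_limit n keep = (\<Inter>k\<in>{1..}. percolation_step n keep k)"

text \<open>
  The decisions are independent events of probability \<open>p\<close>. Joint independence of all decisions,
  over all levels, includes independence of earlier choices.
\<close>
definition percolation_process ::
    "'w measure \<Rightarrow> real \<Rightarrow> nat \<Rightarrow> (nat \<times> nat \<times> nat \<Rightarrow> 'w \<Rightarrow> bool) \<Rightarrow> bool" where
  "percolation_process P p n keep \<longleftrightarrow>
     prob_space P \<and>
     prob_space.indep_vars P (\<lambda>_. count_space UNIV) keep (percolation_index n) \<and>
     (\<forall>c\<in>percolation_index n. measure P {\<omega> \<in> space P. keep c \<omega>} = p)"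

end

(*
  Removing from M the limit of all level-k squares that avoid a given point x leaves a small open
  neighbourhood of x in M. Its boundary points lie in squares of every level that descend from two
  different, touching level-k squares. About n^l pairs of level-l squares can do so, and both
  members survive with probability of order p^(2l), so the boundaries have dimension at most
  1 + 2 log p / log n, and hence M has topological Hausdorff dimension at most
  2 + 2 log p / log n, or 0 if the boundaries are empty.

  Almost surely on non-extinction dim_H M is at least t whenever n^t < n^2 p. By compactness a
  cover of M by small sets yields a cutset of the tree of kept squares, so it suffices that the
  minimal cutset weight F, where a level-k square weighs theta^k with theta = n^(-t), is positive.
  For finite depth F satisfies F' = min 1 (theta * sum of F over the kept children). A second
  moment estimate keeps the expectation of F bounded away from 0, and since P(F = 0) < 1 is a
  subsolution of the fixed point equation of the offspring generating function, it is at most the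
  extinction probability.
*)
theory Submission
  imports Defs
begin

section \<open>The tree of kept squares\<close>

text \<open>Neither dimension is computed exactly. Since p < 1, there is room between n p^2 and n p,
  and exponents inserted there separate an upper bound d for one dimension from a lower bound t for
  the other. Two obstacles shape the proof. First, the exceptional null set must not depend on the
  point x or on its neighbourhood. Therefore all boundaries that arise at level k are enclosed in
  one random set depending on k alone, and only countably many almost sure statements remain.
  Second, the lower bound must hold almost surely on non-extinction, whereas the second moment
  estimate yields only positive probability. Convexity of the generating function closes this gap.
  The sample space is arbitrary, so self-similarity is available only in law: the decisions below a
  level-1 square are re-indexed into another percolation over the same space, and expectations of
  measurable functionals of the decisions depend on p and n alone.\<close>

definition ancestor :: "nat \<Rightarrow> nat \<Rightarrow> nat \<times> nat \<Rightarrow> nat \<times> nat" where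
  "ancestor n m c = (fst c div n ^ m, snd c div n ^ m)"

text \<open>Turns a level-\<open>k\<close> position relative to the level-1 square \<open>c\<close>
  into an absolute level-\<open>Suc k\<close> position: \<open>c\<close> supplies the leading
  base-\<open>n\<close> digit of each coordinate.\<close>

definition descend :: "nat \<Rightarrow> nat \<times> nat \<Rightarrow> nat \<times> nat \<times> nat \<Rightarrow> nat \<times> nat \<times> nat" where
  "descend n c = (\<lambda>(k, a, b). (Suc k, fst c * n ^ k + a, snd c * n ^ k + b))"

definition subtree ::
    "nat \<Rightarrow> nat \<times> nat \<Rightarrow> (nat \<times> nat \<times> nat \<Rightarrow> bool) \<Rightarrow> nat \<times> nat \<times> nat \<Rightarrow> bool" where
  "subtree n c kp = (\<lambda>x. kp (descend n c x))"

definition children :: "nat \<Rightarrow> (nat \<times> nat) set" where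
  "children n = {..<n} \<times> {..<n}"

lemma finite_children [simp]: "finite (children n)"
  and card_children [simp]: "card (children n) = n\<^sup>2"
  by (simp_all add: children_def power2_eq_square)

lemma ancestor_0 [simp]: "ancestor n 0 c = c"
  by (simp add: ancestor_def)

lemma ancestor_ancestor: "ancestor n l (ancestor n m c) = ancestor n (m + l) c"
  by (simp add: ancestor_def div_mult2_eq power_add)

lemma ancestor_mono:
  assumes "ancestor n m a = ancestor n m b" "m \<le> l"
  shows "ancestor n l a = ancestor n l b"
  using assms by (metis ancestor_ancestor le_add_diff_inverse)

lemma kept_squares_less:
  assumes "0 < n" "(i, j) \<in> kept_squares n kp k"
  shows "i < n ^ k \<and> j < n ^ k"
  using assms(2)
proof (induction k arbitrary: i j)
  case (Suc k)
  then have "i div n < n ^ k \<and> j div n < n ^ k" by auto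
  then have "i < n ^ k * n \<and> j < n ^ k * n"
    using assms(1) by (simp add: div_less_iff_less_mult)
  then show ?case by (simp add: mult.commute)
qed simp

lemma kept_squares_subset: "0 < n \<Longrightarrow> kept_squares n kp k \<subseteq> {..<n ^ k} \<times> {..<n ^ k}"
  using kept_squares_less by fastforce

lemma finite_kept_squares: "0 < n \<Longrightarrow> finite (kept_squares n kp k)"
  by (rule finite_subset[OF kept_squares_subset]) auto

lemma ancestor_kept_squares:
  assumes "c \<in> kept_squares n kp (k + m)"
  shows "ancestor n m c \<in> kept_squares n kp k"
  using assms
proof (induction m arbitrary: c)
  case (Suc m)
  then have "ancestor n 1 c \<in> kept_squares n kp (k + m)"
    by (auto simp: ancestor_def)
  from Suc.IH[OF this] show ?case by (simp add: ancestor_ancestor)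
qed simp

lemma kept_squares_keep:
  assumes "c \<in> kept_squares n kp (Suc k + m)"
  shows "kp (Suc k, ancestor n m c)"
  using ancestor_kept_squares[OF assms] by auto

text \<open>\<open>kept_squares\<close> recurses at the finest level, whereas branching arguments
  split at the root; this converts one into the other. The quotient by \<open>n ^ k\<close> is the
  level-1 ancestor and the remainder the position inside it, and both are compatible with
  \<open>div n\<close>.\<close>

lemma kept_squares_Suc_iff:
  assumes "0 < n"
  shows "(x, y) \<in> kept_squares n kp (Suc k) \<longleftrightarrow>
     (x div n ^ k, y div n ^ k) \<in> children n \<and> kp (1, x div n ^ k, y div n ^ k) \<and>
     (x mod n ^ k, y mod n ^ k) \<in> kept_squares n (subtree n (x div n ^ k, y div n ^ k) kp) k"
proof (induction k arbitrary: x y)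
  case 0
  then show ?case using assms by (auto simp: children_def div_eq_0_iff)
next
  case (Suc k)
  have *: "z div n div n ^ k = z div n ^ Suc k" for z
    by (simp add: div_mult2_eq)
  have **: "z div n mod n ^ k = z mod n ^ Suc k div n" for z
    by (simp add: mod_mult2_eq assms)
  have ***: "z div n ^ Suc k * n ^ Suc k + z mod n ^ Suc k = z" for z
    by (rule div_mult_mod_eq)
  have "(x, y) \<in> kept_squares n kp (Suc (Suc k)) \<longleftrightarrow>
      (x div n, y div n) \<in> kept_squares n kp (Suc k) \<and> kp (Suc (Suc k), x, y)"
    by simp
  also have "\<dots> \<longleftrightarrow> (x div n ^ Suc k, y div n ^ Suc k) \<in> children n \<and>
      kp (1, x div n ^ Suc k, y div n ^ Suc k) \<and>
      (x mod n ^ Suc k div n, y mod n ^ Suc k div n)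
        \<in> kept_squares n (subtree n (x div n ^ Suc k, y div n ^ Suc k) kp) k
      \<and> subtree n (x div n ^ Suc k, y div n ^ Suc k) kp (Suc k, x mod n ^ Suc k, y mod n ^ Suc k)"
    unfolding Suc.IH * ** by (auto simp only: subtree_def descend_def split fst_conv snd_conv ***)
  finally show ?case by simp
qed

lemma kept_squares_child:
  assumes "0 < n" "c \<in> children n" "kp (1, c)" "(a, b) \<in> kept_squares n (subtree n c kp) k"
  shows "(fst c * n ^ k + a, snd c * n ^ k + b) \<in> kept_squares n kp (Suc k)"
proof -
  have "a < n ^ k" "b < n ^ k" using kept_squares_less[OF assms(1,4)] by auto
  then have "(fst c * n ^ k + a) div n ^ k = fst c" "(snd c * n ^ k + b) div n ^ k = snd c"
    "(fst c * n ^ k + a) mod n ^ k = a" "(snd c * n ^ k + b) mod n ^ k = b"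
    using assms(1) by auto
  then show ?thesis
    unfolding kept_squares_Suc_iff[OF assms(1)] using assms(2-4) by simp
qed

lemma kept_squares_Suc_eq_empty_iff:
  assumes "0 < n"
  shows "kept_squares n kp (Suc k) \<noteq> {} \<longleftrightarrow>
    (\<exists>c\<in>children n. kp (1, c) \<and> kept_squares n (subtree n c kp) k \<noteq> {})" (is "?L \<longleftrightarrow> ?R")
proof
  assume ?L
  then obtain x y where "(x, y) \<in> kept_squares n kp (Suc k)" by auto
  then show ?R unfolding kept_squares_Suc_iff[OF assms] by blast
next
  assume ?R
  then show ?L using kept_squares_child[OF assms] by fast
qed

text \<open>Uniqueness of quotient and remainder modulo \<open>n ^ k\<close>. It separates the
  subtrees of different children, both when weights are added and when independence is
  needed.\<close>

lemma descend_inject: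
  assumes "descend n c (k, a, b) = descend n c' (k', a', b')"
    and "a < n ^ k" "b < n ^ k" "a' < n ^ k'" "b' < n ^ k'"
  shows "c = c' \<and> k = k' \<and> a = a' \<and> b = b'"
proof -
  have eq: "k' = k" "fst c * n ^ k + a = fst c' * n ^ k + a'" "snd c * n ^ k + b = snd c' * n ^ k + b'"
    using assms(1) by (auto simp: descend_def)
  have *: "x = x' \<and> y = y'" if "x * n ^ k + y = x' * n ^ k + y'" "y < n ^ k" "y' < n ^ k" for x y x' y'
  proof -
    have "n ^ k > 0" using that(2) by linarith
    moreover have "(x * n ^ k + y) div n ^ k = (x' * n ^ k + y') div n ^ k" using that(1) by simp
    ultimately have "x = x'" using that(2,3) by simp
    then show ?thesis using that(1) by simp
  qed
  show ?thesis using *[OF eq(2)] *[OF eq(3)] assms(2-5) eq(1) by (auto simp: prod_eq_iff)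
qed

lemma inj_on_descend: "inj_on (descend n c) A"
  by (auto simp: inj_on_def descend_def)

section \<open>Minimal weights of cutsets\<close>

text \<open>Least weight of a cutset of depth at most \<open>l\<close>: either the root is taken, at
  cost 1, or each kept child is cut separately, all weights there being scaled by \<theta>.\<close>

primrec cut_value :: "nat \<Rightarrow> real \<Rightarrow> nat \<Rightarrow> (nat \<times> nat \<times> nat \<Rightarrow> bool) \<Rightarrow> real" where
  "cut_value n \<theta> 0 kp = 1"
| "cut_value n \<theta> (Suc l) kp =
     min 1 (\<theta> * (\<Sum>c\<in>children n. if kp (1, c) then cut_value n \<theta> l (subtree n c kp) else 0))"

lemma cut_value_le_1: "cut_value n \<theta> l kp \<le> 1"
  by (cases l) auto

lemma cut_value_nonneg: "0 \<le> \<theta> \<Longrightarrow> 0 \<le> cut_value n \<theta> l kp"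
  by (induction l arbitrary: kp) (auto intro!: sum_nonneg mult_nonneg_nonneg)

text \<open>A larger depth admits more cutsets.\<close>

lemma cut_value_Suc_le:
  assumes "0 \<le> \<theta>"
  shows "cut_value n \<theta> (Suc l) kp \<le> cut_value n \<theta> l kp"
proof (induction l arbitrary: kp)
  case (Suc l)
  show ?case
    unfolding cut_value.simps(2)[of n \<theta> "Suc l"]
    by (subst cut_value.simps(2)[of n \<theta> "l"])
      (intro min.mono mult_left_mono sum_mono assms order_refl, simp add: Suc.IH del: cut_value.simps)
qed simp

lemma cut_value_antimono:
  assumes "0 \<le> \<theta>" "l \<le> m"
  shows "cut_value n \<theta> m kp \<le> cut_value n \<theta> l kp"
  using assms(2) by (induction rule: dec_induct) (auto intro: order_trans[OF cut_value_Suc_le[OF assms(1)]] simp del: cut_value.simps)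

text \<open>A single child's term is at most 1, so the truncation does not affect it.\<close>

lemma cut_value_Suc_ge_child:
  assumes "0 \<le> \<theta>" "\<theta> \<le> 1" "c \<in> children n" "kp (1, c)"
  shows "\<theta> * cut_value n \<theta> l (subtree n c kp) \<le> cut_value n \<theta> (Suc l) kp"
proof -
  let ?g = "\<lambda>c. if kp (1, c) then cut_value n \<theta> l (subtree n c kp) else 0"
  have "?g c \<le> sum ?g (children n)"
    using assms by (intro member_le_sum) (auto simp: cut_value_nonneg)
  then have "\<theta> * ?g c \<le> \<theta> * sum ?g (children n)"
    using assms(1) by (rule mult_left_mono)
  moreover have "\<theta> * ?g c \<le> 1"
    using assms by (intro mult_le_one) (auto simp: cut_value_nonneg cut_value_le_1)
  ultimately show ?thesis using assms(4) by simp
qed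

text \<open>A cutset without the root splits into cutsets of the subtrees of the kept children.
  \<open>A\<close> may contain arbitrary triples, because it will be read off from a geometric
  cover.\<close>

lemma cut_value_le_cutset:
  assumes "0 < n" "0 \<le> \<theta>" "finite A"
    and "\<And>c. c \<in> kept_squares n kp L \<Longrightarrow> \<exists>k\<le>L. (k, ancestor n (L - k) c) \<in> A"
  shows "cut_value n \<theta> L kp \<le> (\<Sum>x\<in>A. \<theta> ^ fst x)"
  using assms(3,4)
proof (induction L arbitrary: kp A)
  case 0
  then have "(0, 0, 0) \<in> A" by auto
  then have "\<theta> ^ fst (0::nat, 0::nat, 0::nat) \<le> (\<Sum>x\<in>A. \<theta> ^ fst x)"
    using 0 assms(2) by (intro member_le_sum) auto
  then show ?case by simp
next
  case (Suc L)
  show ?case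
  proof (cases "(0, 0, 0) \<in> A")
    case True
    then have "\<theta> ^ fst (0::nat, 0::nat, 0::nat) \<le> (\<Sum>x\<in>A. \<theta> ^ fst x)"
      using Suc assms(2) by (intro member_le_sum) auto
    then show ?thesis using cut_value_le_1[of n \<theta> "Suc L" kp] by simp
  next
    case False
    \<comment> \<open>The part of \<open>A\<close> below \<open>c\<close>, in coordinates relative
      to \<open>c\<close>. The bounds on \<open>a\<close> and \<open>b\<close> make
      \<open>descend\<close> injective across all children, so no member of \<open>A\<close> is
      counted twice.\<close>
    define B where "B c = {(k, a, b). a < n ^ k \<and> b < n ^ k \<and> descend n c (k, a, b) \<in> A}" for c
    have fin: "finite (B c)" for c
      by (rule inj_on_finite[OF inj_on_descend[of n c] _ Suc.prems(1)]) (auto simp: B_def)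
    have child: "cut_value n \<theta> L (subtree n c kp) \<le> (\<Sum>x\<in>B c. \<theta> ^ fst x)"
      if c: "c \<in> children n" "kp (1, c)" for c
    proof (rule Suc.IH[OF fin])
      fix e assume "e \<in> kept_squares n (subtree n c kp) L"
      then obtain a b where e: "e = (a, b)" "(a, b) \<in> kept_squares n (subtree n c kp) L"
        by (cases e) auto
      have ab: "a < n ^ L" "b < n ^ L" using kept_squares_less[OF assms(1) e(2)] by auto
      obtain k where k: "k \<le> Suc L"
          "(k, ancestor n (Suc L - k) (fst c * n ^ L + a, snd c * n ^ L + b)) \<in> A"
        using Suc.prems(2)[OF kept_squares_child[OF assms(1) c e(2)]] by blast
      have small: "(fst c * n ^ L + a, snd c * n ^ L + b) \<in> {..<n ^ Suc L} \<times> {..<n ^ Suc L}"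
        using kept_squares_child[OF assms(1) c e(2)] kept_squares_subset[OF assms(1)] by blast
      \<comment> \<open>At level 0 the ancestor of every admissible position is the root, which is
        not in \<open>A\<close>.\<close>
      have "k \<noteq> 0"
      proof
        assume "k = 0"
        with k(2) small False show False by (simp add: ancestor_def)
      qed
      then obtain l where l: "k = Suc l" "l \<le> L" using k(1) by (cases k) auto
      have split: "n ^ L = n ^ l * n ^ (L - l)" using l(2) by (simp flip: power_add)
      have anc: "(z * n ^ L + w) div n ^ (L - l) = z * n ^ l + w div n ^ (L - l)" for z w :: nat
        using assms(1) by (simp add: split flip: mult.assoc)
      have lt: "w div n ^ (L - l) < n ^ l" if "w < n ^ L" for w
        using that assms(1) by (simp add: split div_less_iff_less_mult)
      have "(l, ancestor n (L - l) (a, b)) \<in> B c"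
        using k(2) lt ab by (simp add: B_def l(1) ancestor_def descend_def anc)
      then show "\<exists>k\<le>L. (k, ancestor n (L - k) e) \<in> B c" using l e by blast
    qed
    let ?D = "Sigma (children n) B"
    have inj2: "inj_on (\<lambda>(c, x). descend n c x) ?D"
    proof (rule inj_onI)
      fix u v assume uv: "u \<in> ?D" "v \<in> ?D" "(\<lambda>(c, x). descend n c x) u = (\<lambda>(c, x). descend n c x) v"
      obtain c k a b where u: "u = (c, k, a, b)" by (metis prod.exhaust)
      obtain c' k' a' b' where v: "v = (c', k', a', b')" by (metis prod.exhaust)
      show "u = v"
        using uv descend_inject[of n c k a b c' k' a' b'] by (auto simp: u v B_def)
    qed
    have "cut_value n \<theta> (Suc L) kp \<le> \<theta> * (\<Sum>c\<in>children n. \<Sum>x\<in>B c. \<theta> ^ fst x)"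
      using assms(2)
      by (auto intro!: min.coboundedI2 mult_left_mono sum_mono child sum_nonneg)
    also have "\<dots> = (\<Sum>u\<in>?D. \<theta> ^ Suc (fst (snd u)))"
      using fin by (subst sum.Sigma) (auto simp: sum_distrib_left intro!: sum.cong)
    also have "\<dots> = (\<Sum>u\<in>?D. \<theta> ^ fst ((\<lambda>(c, x). descend n c x) u))"
      by (intro sum.cong) (auto simp: descend_def)
    also have "\<dots> = (\<Sum>x\<in>(\<lambda>(c, x). descend n c x) ` ?D. \<theta> ^ fst x)"
      by (subst sum.reindex[OF inj2]) simp
    also have "\<dots> \<le> (\<Sum>x\<in>A. \<theta> ^ fst x)"
      using assms(2) by (intro sum_mono2 Suc.prems(1)) (auto simp: B_def)
    finally show ?thesis .
  qed
qed

section \<open>Hausdorff dimension of the limit set and of its boundaries\<close>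

lemma hausdorff_premeasure_mono:
  assumes "A \<subseteq> B"
  shows "hausdorff_premeasure s \<delta> A \<le> hausdorff_premeasure s \<delta> B"
  unfolding hausdorff_premeasure_def using assms by (intro Inf_superset_mono) blast

lemma hausdorff_measure_mono:
  assumes "A \<subseteq> B"
  shows "hausdorff_measure s A \<le> hausdorff_measure s B"
  unfolding hausdorff_measure_def using assms by (intro SUP_mono' hausdorff_premeasure_mono)

lemma minus_one_le_ereal: "0 \<le> x \<Longrightarrow> -1 \<le> ereal x"
  by (simp add: one_ereal_def)

lemma hausdorff_dim_ge_minus_1: "-1 \<le> hausdorff_dim A"
  unfolding hausdorff_dim_def by (auto intro!: Inf_greatest minus_one_le_ereal)

lemma hausdorff_dim_mono:
  assumes "A \<subseteq> B"
  shows "hausdorff_dim A \<le> hausdorff_dim B"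
proof (cases "A = {}")
  case True
  then show ?thesis using hausdorff_dim_ge_minus_1[of B] by (simp add: hausdorff_dim_def)
next
  case False
  have "hausdorff_measure s A = 0" if "hausdorff_measure s B = 0" for s
    using hausdorff_measure_mono[OF assms, of s] that by simp
  then show ?thesis using False assms
    unfolding hausdorff_dim_def by (auto intro!: Inf_superset_mono)
qed

lemma hausdorff_dim_le:
  assumes "0 \<le> s" "hausdorff_measure s A = 0"
  shows "hausdorff_dim A \<le> ereal s"
proof (cases "A = {}")
  case True
  then show ?thesis using assms(1) by (simp add: hausdorff_dim_def minus_one_le_ereal)
next
  case False
  then show ?thesis using assms by (auto simp: hausdorff_dim_def intro: Inf_lower)
qed

section \<open>Geometry of the grid and compactness\<close>

lemma mem_grid_square:
  assumes "0 < n"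
  shows "z \<in> grid_square n k c \<longleftrightarrow>
    real (fst c) \<le> fst z * real n ^ k \<and> fst z * real n ^ k \<le> real (fst c) + 1 \<and>
    real (snd c) \<le> snd z * real n ^ k \<and> snd z * real n ^ k \<le> real (snd c) + 1"
  using assms
  by (cases z, cases c) (auto simp: grid_square_def pos_divide_le_eq pos_le_divide_eq add.commute)

lemma compact_grid_square: "compact (grid_square n k c)"
  by (cases c) (simp add: grid_square_def compact_Times)

lemma corner_in_grid_square:
  assumes "0 < n"
  shows "(real (fst c) / real n ^ k, real (snd c) / real n ^ k) \<in> grid_square n k c"
  using assms by (simp add: mem_grid_square)

lemma grid_square_ancestor:
  assumes "0 < n" "z \<in> grid_square n (k + m) c"
  shows "z \<in> grid_square n k (ancestor n m c)"
proof -
  have *: "real (i div n ^ m) \<le> X \<and> X \<le> real (i div n ^ m) + 1"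
    if "real i \<le> X * real n ^ m" "X * real n ^ m \<le> real i + 1" for i X
  proof
    have "i div n ^ m * n ^ m \<le> i" by (simp add: div_times_less_eq_dividend)
    then have "real (i div n ^ m * n ^ m) \<le> real i" by (rule of_nat_mono)
    then have "real (i div n ^ m) * real n ^ m \<le> real i" by simp
    then have "real (i div n ^ m) * real n ^ m \<le> X * real n ^ m" using that by simp
    then show "real (i div n ^ m) \<le> X" using assms(1) by simp
    have "i < (i div n ^ m + 1) * n ^ m" using assms(1) by (simp add: dividend_less_div_times)
    then have "i + 1 \<le> (i div n ^ m + 1) * n ^ m" by simp
    then have "real (i + 1) \<le> real ((i div n ^ m + 1) * n ^ m)" by (rule of_nat_mono)
    then have "real i + 1 \<le> (real (i div n ^ m) + 1) * real n ^ m" by (simp add: algebra_simps)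
    then have "X * real n ^ m \<le> (real (i div n ^ m) + 1) * real n ^ m" using that by simp
    then show "X \<le> real (i div n ^ m) + 1" using assms(1) by simp
  qed
  show ?thesis
    using assms(2) *[of "fst c" "fst z * real n ^ k"] *[of "snd c" "snd z * real n ^ k"]
    by (simp add: mem_grid_square[OF assms(1)] ancestor_def power_add mult.assoc)
qed

lemma dist_grid_square:
  assumes "0 < n" "z \<in> grid_square n k c" "w \<in> grid_square n k c"
  shows "dist z w \<le> 2 / real n ^ k"
proof -
  have "\<bar>fst z - fst w\<bar> * real n ^ k \<le> 1" "\<bar>snd z - snd w\<bar> * real n ^ k \<le> 1"
    using assms(2,3) unfolding mem_grid_square[OF assms(1)]
    by (auto simp: abs_if algebra_simps)
  then have "\<bar>fst z - fst w\<bar> \<le> 1 / real n ^ k" "\<bar>snd z - snd w\<bar> \<le> 1 / real n ^ k"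
    using assms(1) by (simp_all add: pos_le_divide_eq)
  moreover have "dist z w \<le> \<bar>fst z - fst w\<bar> + \<bar>snd z - snd w\<bar>"
    unfolding dist_prod_def by (simp add: dist_real_def sqrt_sum_squares_le_sum_abs[THEN order_trans])
  ultimately show ?thesis by simp
qed

lemma diameter_grid_square:
  assumes "0 < n"
  shows "diameter (grid_square n k c) \<le> 2 / real n ^ k"
  using assms by (intro diameter_le) (auto intro: dist_grid_square simp flip: dist_norm)

lemma percolation_step_antimono:
  assumes "0 < n" "k \<le> l"
  shows "percolation_step n kp l \<subseteq> percolation_step n kp k"
proof -
  obtain m where l: "l = k + m" using assms(2) le_iff_add by blast
  show ?thesis
  proof
    fix z assume "z \<in> percolation_step n kp l"
    then obtain c where "c \<in> kept_squares n kp (k + m)" "z \<in> grid_square n (k + m) c"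
      by (auto simp: percolation_step_def l)
    then have "ancestor n m c \<in> kept_squares n kp k" "z \<in> grid_square n k (ancestor n m c)"
      by (simp_all add: ancestor_kept_squares grid_square_ancestor[OF assms(1)])
    then show "z \<in> percolation_step n kp k" unfolding percolation_step_def by blast
  qed
qed

lemma percolation_limit_eq:
  assumes "0 < n"
  shows "percolation_limit n kp = (\<Inter>k. percolation_step n kp k)"
proof -
  have "percolation_limit n kp \<subseteq> percolation_step n kp k" for k
    using percolation_step_antimono[OF assms, of k "Suc k" kp] by (auto simp: percolation_limit_def)
  then show ?thesis by (auto simp: percolation_limit_def)
qed

lemma compact_percolation_step: "0 < n \<Longrightarrow> compact (percolation_step n kp k)"
  unfolding percolation_step_def by (intro compact_UN finite_kept_squares compact_grid_square)

lemma compact_percolation_limit: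
  assumes "0 < n"
  shows "compact (percolation_limit n kp)"
  unfolding percolation_limit_eq[OF assms] using compact_percolation_step[OF assms]
  by (intro compact_Inter) auto

lemma percolation_limit_empty:
  assumes "0 < n" "kept_squares n kp k = {}"
  shows "percolation_limit n kp = {}"
  using assms by (auto simp: percolation_limit_eq percolation_step_def)

text \<open>The compact sets \<open>percolation_step n kp k - W\<close> decrease to the empty set,
  so one of them is already empty.\<close>

lemma percolation_step_subset_open:
  assumes "0 < n" "open W" "percolation_limit n kp \<subseteq> W"
  obtains k where "percolation_step n kp k \<subseteq> W"
proof (rule ccontr)
  assume "\<not> thesis"
  then have "percolation_step n kp k - W \<noteq> {}" for k using that by blast
  then have "(\<Inter>k. percolation_step n kp k - W) \<noteq> {}"
    using assms
    by (intro compact_nest compact_diff compact_percolation_step Diff_mono percolation_step_antimono) auto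
  then show False using assms by (auto simp: percolation_limit_eq)
qed

text \<open>Squares of side \<open>1 / n ^ (l + k)\<close> have diameter at most twice that, so the
  cover by \<open>A k\<close> costs only a constant factor \<open>2 powr s\<close> more than the
  null sequence.\<close>

lemma hausdorff_measure_grid_cover:
  assumes "2 \<le> n" "0 \<le> s" "\<And>k. finite (A k)"
    and "\<And>k. E \<subseteq> (\<Union>c\<in>A k. grid_square n (l + k) c)"
    and "(\<lambda>k. real (card (A k)) * (1 / real n ^ (l + k)) powr s) \<longlonglongrightarrow> 0"
  shows "hausdorff_measure s E = 0"
proof -
  have n: "0 < n" using assms(1) by simp
  have "hausdorff_premeasure s \<delta> E = 0" if \<delta>: "0 < \<delta>" for \<delta>
  proof -
    have "hausdorff_premeasure s \<delta> E \<le> 0 + ennreal \<epsilon>" if \<epsilon>: "0 < \<epsilon>" for \<epsilon>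
    proof -
      have "(\<lambda>k. 2 powr s * (real (card (A k)) * (1 / real n ^ (l + k)) powr s)) \<longlonglongrightarrow> 2 powr s * 0"
        by (intro tendsto_intros assms)
      then have ev1: "\<forall>\<^sub>F k in sequentially. 2 powr s * (real (card (A k)) * (1 / real n ^ (l + k)) powr s) < \<epsilon>"
        using \<epsilon> by (intro order_tendstoD(2)) auto
      have "(\<lambda>k. 2 * inverse (real n ^ (l + k))) \<longlonglongrightarrow> 2 * 0"
        using LIMSEQ_ignore_initial_segment[OF LIMSEQ_inverse_realpow_zero[of "real n"], of l] assms(1)
        by (intro tendsto_mult tendsto_const) (auto simp: add.commute)
      then have ev2: "\<forall>\<^sub>F k in sequentially. 2 * inverse (real n ^ (l + k)) < \<delta>"
        using \<delta> by (intro order_tendstoD(2)) auto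
      obtain k where k: "2 powr s * (real (card (A k)) * (1 / real n ^ (l + k)) powr s) < \<epsilon>" "2 / real n ^ (l + k) < \<delta>"
        using eventually_happens[OF eventually_conj[OF ev1 ev2]] by (auto simp: field_simps)
      obtain f where f: "bij_betw f {..<card (A k)} (A k)"
        using ex_bij_betw_nat_finite[OF assms(3)[of k]] by (auto simp: atLeast0LessThan)
      define U where "U i = (if i < card (A k) then grid_square n (l + k) (f i) else {})" for i
      have dp: "diam_pow s (U i) \<le> ennreal ((2 / real n ^ (l + k)) powr s)" for i
      proof (cases "s = 0")
        case True
        then show ?thesis using n by (simp add: diam_pow_def)
      next
        case False
        then have "diameter (U i) powr s \<le> (2 / real n ^ (l + k)) powr s"
          using assms(2) diameter_grid_square[OF n] n
          by (intro powr_mono2) (auto simp: U_def diameter_ge_0 compact_imp_bounded compact_grid_square diameter_empty)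
        then show ?thesis using False by (simp add: diam_pow_def ennreal_leI)
      qed
      have "E \<subseteq> (\<Union>i\<in>{..<card (A k)}. grid_square n (l + k) (f i))"
        using assms(4)[of k] bij_betw_imp_surj_on[OF f] by (metis image_image)
      also have "\<dots> \<subseteq> (\<Union>i. U i)" by (auto simp: U_def)
      finally have "E \<subseteq> (\<Union>i. U i)" .
      moreover have "bounded (U i) \<and> diameter (U i) \<le> \<delta>" for i
        using diameter_grid_square[OF n, of "l + k" "f i"] k(2) \<delta>
        by (auto simp: U_def compact_imp_bounded compact_grid_square diameter_empty)
      ultimately have "hausdorff_premeasure s \<delta> E \<le> (\<Sum>i. diam_pow s (U i))"
        unfolding hausdorff_premeasure_def by (intro Inf_lower) blast
      also have "\<dots> = (\<Sum>i<card (A k). diam_pow s (U i))"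
        by (intro suminf_finite) (auto simp: U_def diam_pow_def)
      also have "\<dots> \<le> (\<Sum>i<card (A k). ennreal ((2 / real n ^ (l + k)) powr s))"
        by (intro sum_mono dp)
      also have "\<dots> = ennreal (real (card (A k)) * (2 / real n ^ (l + k)) powr s)"
        by (simp add: ennreal_mult' ennreal_of_nat_eq_real_of_nat)
      also have "real (card (A k)) * (2 / real n ^ (l + k)) powr s = 2 powr s * (real (card (A k)) * (1 / real n ^ (l + k)) powr s)"
        using powr_mult[of 2 "1 / real n ^ (l + k)" s] by simp
      finally show ?thesis using k(1) by (simp add: ennreal_leI order_trans[OF _ ennreal_leI])
    qed
    then show ?thesis using ennreal_le_epsilon[of 0 "hausdorff_premeasure s \<delta> E"] by simp
  qed
  then show ?thesis unfolding hausdorff_measure_def by simp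
qed

text \<open>Rounds a radius to a grid level; the price is a factor of at most
  \<open>n\<close>.\<close>

lemma exists_scale:
  fixes \<rho> :: real
  assumes "2 \<le> n" "0 < \<rho>" "\<rho> < 1"
  obtains k where "\<rho> * real n ^ k < 1" "1 \<le> \<rho> * real n ^ Suc k"
proof -
  obtain l where "1 / \<rho> < real n ^ l" using real_arch_pow[of "real n" "1 / \<rho>"] assms(1) by auto
  then have "1 \<le> \<rho> * real n ^ l" using assms(2) by (simp add: field_simps)
  also have "\<dots> \<le> \<rho> * real n ^ Suc l" using assms by (intro mult_left_mono power_increasing) auto
  finally have ex: "\<exists>k. 1 \<le> \<rho> * real n ^ Suc k" by blast
  define k where "k = (LEAST k. 1 \<le> \<rho> * real n ^ Suc k)"
  have "1 \<le> \<rho> * real n ^ Suc k" unfolding k_def by (rule LeastI_ex[OF ex])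
  moreover have "\<rho> * real n ^ k < 1"
  proof (cases k)
    case (Suc j)
    then have "\<not> 1 \<le> \<rho> * real n ^ Suc j" unfolding k_def using not_less_Least by (metis lessI)
    then show ?thesis using Suc by simp
  qed (use assms in simp)
  ultimately show ?thesis by (rule that[rotated])
qed

lemma sum_UN_le:
  fixes f :: "'a \<Rightarrow> real"
  assumes "finite J" "\<And>i. i \<in> J \<Longrightarrow> finite (B i)" "\<And>x. 0 \<le> f x"
  shows "sum f (\<Union>i\<in>J. B i) \<le> (\<Sum>i\<in>J. sum f (B i))"
  using assms(1,2)
proof (induction J)
  case (insert j J)
  have "sum f (B j \<union> (\<Union>i\<in>J. B i)) + sum f (B j \<inter> (\<Union>i\<in>J. B i)) = sum f (B j) + sum f (\<Union>i\<in>J. B i)"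
    using insert by (intro sum.union_inter) auto
  moreover have "0 \<le> sum f (B j \<inter> (\<Union>i\<in>J. B i))" using assms(3) by (intro sum_nonneg) auto
  moreover have "sum f (\<Union>i\<in>J. B i) \<le> (\<Sum>i\<in>J. sum f (B i))" using insert by auto
  ultimately show ?case using insert by simp
qed simp

text \<open>A cover of small total weight would give a cutset lighter than
  \<open>\<epsilon>\<close>: each covering set is replaced by the few grid squares of comparable
  size near it. As \<open>s < t\<close>, the exponent \<open>t\<close> is positive, so weights
  depend continuously on the diameter even at 0.\<close>

lemma hausdorff_measure_pos:
  assumes "2 \<le> n" "0 \<le> s" "s < t" "0 < \<epsilon>"
    and cut: "\<And>l. \<epsilon> \<le> cut_value n (real n powr - t) l kp"
  shows "hausdorff_measure s (percolation_limit n kp) \<noteq> 0"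
proof
  let ?M = "percolation_limit n kp"
  have n: "0 < n" using assms(1) by simp
  have t: "0 < t" using assms(2,3) by simp
  define \<theta> where "\<theta> = real n powr - t"
  \<comment> \<open>Each covering set yields at most 9 squares, rounding to a level costs
    \<open>n powr t\<close>, and the total weight is at most \<open>2 * \<eta>\<close>; 18 is below
    20.\<close>
  define \<eta> where "\<eta> = \<epsilon> / (20 * real n powr t)"
  have \<eta>: "0 < \<eta>" using assms by (simp add: \<eta>_def)
  assume "hausdorff_measure s ?M = 0"
  then have "hausdorff_premeasure s (1/2) ?M = 0"
    unfolding hausdorff_measure_def by (auto simp: SUP_eq_iff bot_ennreal)
  then have "hausdorff_premeasure s (1/2) ?M < ennreal \<eta>" using \<eta> by simp
  then obtain U where U: "?M \<subseteq> (\<Union>i. U i)" "\<And>i. bounded (U i)" "\<And>i. diameter (U i) \<le> 1/2"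
      "(\<Sum>i::nat. diam_pow s (U i)) < ennreal \<eta>"
    unfolding hausdorff_premeasure_def Inf_less_iff by auto
  define g where "g i = enn2real (diam_pow s (U i))" for i
  have g: "ennreal (g i) = diam_pow s (U i)" for i
    by (auto simp: g_def diam_pow_def)
  have g0: "0 \<le> g i" for i by (simp add: g_def)
  \<comment> \<open>Diameters are enlarged to positive numbers, as a set of diameter 0 has no level
    and the compactness argument needs open balls. The geometric series keeps the extra cost at most
    \<open>\<eta>\<close>.\<close>
  have "\<exists>\<rho>. diameter (U i) < \<rho> \<and> 0 < \<rho> \<and> \<rho> < 1 \<and> \<rho> powr t \<le> g i + \<eta> / 2 ^ Suc i" if "U i \<noteq> {}" for i
  proof -
    let ?d = "diameter (U i)"
    have d: "0 \<le> ?d" "?d \<le> 1/2" using U(2,3) by (auto simp: diameter_ge_0)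
    have "?d powr t \<le> g i"
    proof (cases "s = 0")
      case True
      then show ?thesis using that d t by (simp add: g_def diam_pow_def powr_le1)
    next
      case False
      have "?d powr t \<le> ?d powr s" using d assms(3) by (intro powr_mono') auto
      then show ?thesis using that False by (simp add: g_def diam_pow_def)
    qed
    then have *: "?d powr t < g i + \<eta> / 2 ^ Suc i" using \<eta> by (smt (verit) divide_pos_pos zero_less_power)
    have "((\<lambda>\<rho>. \<rho> powr t) \<longlongrightarrow> ?d powr t) (at_right ?d)"
      using t d by (intro tendsto_powr' tendsto_ident_at tendsto_const)
        (auto simp: eventually_at_right_field intro!: exI[of _ "?d + 1"])
    then have "\<forall>\<^sub>F \<rho> in at_right ?d. \<rho> powr t < g i + \<eta> / 2 ^ Suc i"
      using * by (rule order_tendstoD(2))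
    moreover have "\<forall>\<^sub>F \<rho> in at_right ?d. ?d < \<rho> \<and> \<rho> < 1"
      unfolding eventually_at_right_field using d by (intro exI[of _ 1]) auto
    ultimately have "\<forall>\<^sub>F \<rho> in at_right ?d. \<rho> powr t < g i + \<eta> / 2 ^ Suc i \<and> ?d < \<rho> \<and> \<rho> < 1"
      by eventually_elim auto
    then have "\<exists>\<rho>. \<rho> powr t < g i + \<eta> / 2 ^ Suc i \<and> ?d < \<rho> \<and> \<rho> < 1"
      by (rule eventually_happens'[rotated]) simp
    then show ?thesis using d by fastforce
  qed
  then obtain \<rho> where \<rho>: "\<And>i. U i \<noteq> {} \<Longrightarrow> diameter (U i) < \<rho> i" "\<And>i. U i \<noteq> {} \<Longrightarrow> 0 < \<rho> i"
      "\<And>i. U i \<noteq> {} \<Longrightarrow> \<rho> i < 1" "\<And>i. U i \<noteq> {} \<Longrightarrow> \<rho> i powr t \<le> g i + \<eta> / 2 ^ Suc i"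
    by metis
  have "\<exists>k. \<rho> i * real n ^ k < 1 \<and> 1 \<le> \<rho> i * real n ^ Suc k" if "U i \<noteq> {}" for i
    using exists_scale[OF assms(1) \<rho>(2,3)[OF that]] by blast
  then obtain k where k: "\<And>i. U i \<noteq> {} \<Longrightarrow> \<rho> i * real n ^ k i < 1" "\<And>i. U i \<noteq> {} \<Longrightarrow> 1 \<le> \<rho> i * real n ^ Suc (k i)"
    by metis
  define x where "x i = (SOME y. y \<in> U i)" for i
  have x: "x i \<in> U i" if "U i \<noteq> {}" for i using that by (simp add: x_def some_in_eq)
  define V where "V i = ball (x i) (1 / real n ^ k i)" for i
  have UV: "U i \<subseteq> V i" if "U i \<noteq> {}" for i
  proof
    fix y assume "y \<in> U i"
    then have "dist (x i) y \<le> diameter (U i)" using x[OF that] U(2) by (intro diameter_bounded_bound)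
    also have "\<dots> < \<rho> i" by (rule \<rho>(1)[OF that])
    also have "\<dots> < 1 / real n ^ k i" using k(1)[OF that] n by (simp add: pos_less_divide_eq)
    finally show "y \<in> V i" by (simp add: V_def)
  qed
  have cov: "?M \<subseteq> (\<Union>i\<in>{i. U i \<noteq> {}}. V i)"
  proof
    fix y assume "y \<in> ?M"
    then obtain i where i: "y \<in> U i" using U(1) by blast
    then have "U i \<noteq> {}" by blast
    then show "y \<in> (\<Union>i\<in>{i. U i \<noteq> {}}. V i)" using i UV by blast
  qed
  obtain J where J: "J \<subseteq> {i. U i \<noteq> {}}" "finite J" "?M \<subseteq> (\<Union>i\<in>J. V i)"
    by (rule compactE_image[OF compact_percolation_limit[OF n] _ cov]) (auto simp: V_def)
  obtain K0 where K0: "percolation_step n kp K0 \<subseteq> (\<Union>i\<in>J. V i)"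
    by (rule percolation_step_subset_open[OF n _ J(3)]) (auto simp: V_def)
  \<comment> \<open>Deep enough for the kept squares to lie in the finite subcover and for every cut
    level \<open>k i\<close> to have been reached.\<close>
  define K where "K = K0 + (\<Sum>i\<in>J. k i)"
  have kK: "k i \<le> K" if "i \<in> J" for i
    using member_le_sum[OF that, of k] J(2) by (simp add: K_def)
  \<comment> \<open>The columns of grid squares having a point at distance less than one side length
    from \<open>X\<close>, all in units of that length. Truncated subtraction loses only negative
    integers.\<close>
  define box :: "real \<Rightarrow> nat set" where "box X = {nat \<lfloor>X\<rfloor> - 1..nat \<lfloor>X\<rfloor> + 1}" for X
  have card_box: "card (box X) \<le> 3" for X by (simp add: box_def)
  have in_box: "a \<in> box X" if "real a \<le> Z" "Z \<le> real a + 1" "\<bar>Z - X\<bar> < 1" for a Z X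
    using that unfolding box_def by simp linarith
  define A where "A = (\<Union>i\<in>J. {k i} \<times> (box (fst (x i) * real n ^ k i) \<times> box (snd (x i) * real n ^ k i)))"
  have finA: "finite A" unfolding A_def box_def using J(2) by auto
  have "cut_value n \<theta> K kp \<le> (\<Sum>u\<in>A. \<theta> ^ fst u)"
  proof (rule cut_value_le_cutset[OF n _ finA])
    fix c assume c: "c \<in> kept_squares n kp K"
    \<comment> \<open>The corner need not belong to the limit set, but it lies in
      \<open>percolation_step\<close>, which the balls cover. So kept squares with a finite lineage
      are cut as well.\<close>
    let ?z = "(real (fst c) / real n ^ K, real (snd c) / real n ^ K)"
    have z: "?z \<in> grid_square n K c" by (rule corner_in_grid_square[OF n])
    then have "?z \<in> percolation_step n kp K" using c by (auto simp: percolation_step_def)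
    then have "?z \<in> (\<Union>i\<in>J. V i)"
      using K0 percolation_step_antimono[OF n, of K0 K kp] by (auto simp: K_def)
    then obtain i where i: "i \<in> J" "dist (x i) ?z < 1 / real n ^ k i" by (auto simp: V_def)
    define b where "b = ancestor n (K - k i) c"
    have zb: "?z \<in> grid_square n (k i) b"
      unfolding b_def using z kK[OF i(1)] by (intro grid_square_ancestor[OF n]) simp
    have "dist (fst (x i)) (fst ?z) < 1 / real n ^ k i" "dist (snd (x i)) (snd ?z) < 1 / real n ^ k i"
      using i(2) dist_fst_le[of "x i" ?z] dist_snd_le[of "x i" ?z] by linarith+
    then have "\<bar>fst ?z - fst (x i)\<bar> * real n ^ k i < 1" "\<bar>snd ?z - snd (x i)\<bar> * real n ^ k i < 1"
      using n by (simp_all add: pos_less_divide_eq dist_real_def abs_minus_commute)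
    then have "\<bar>fst ?z * real n ^ k i - fst (x i) * real n ^ k i\<bar> < 1"
        "\<bar>snd ?z * real n ^ k i - snd (x i) * real n ^ k i\<bar> < 1"
      by (simp_all only: left_diff_distrib[symmetric] abs_mult abs_of_nonneg[OF zero_le_power[OF of_nat_0_le_iff]])
    then have "fst b \<in> box (fst (x i) * real n ^ k i)" "snd b \<in> box (snd (x i) * real n ^ k i)"
      using zb unfolding mem_grid_square[OF n] by (blast intro: in_box)+
    then have "(k i, b) \<in> A" unfolding A_def using i(1) by (cases b) auto
    then show "\<exists>k\<le>K. (k, ancestor n (K - k) c) \<in> A" using kK[OF i(1)] b_def by blast
  qed (simp add: \<theta>_def)
  also have "\<dots> \<le> (\<Sum>i\<in>J. \<Sum>u\<in>{k i} \<times> (box (fst (x i) * real n ^ k i) \<times> box (snd (x i) * real n ^ k i)). \<theta> ^ fst u)"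
    unfolding A_def using J(2) by (intro sum_UN_le) (auto simp: \<theta>_def box_def)
  also have "\<dots> \<le> (\<Sum>i\<in>J. 9 * real n powr t * (g i + \<eta> / 2 ^ Suc i))"
  proof (rule sum_mono)
    fix i assume "i \<in> J"
    then have i: "U i \<noteq> {}" using J by blast
    let ?B = "box (fst (x i) * real n ^ k i) \<times> box (snd (x i) * real n ^ k i)"
    have "card ?B \<le> 3 * 3" unfolding card_cartesian_product by (intro mult_mono card_box) auto
    have "(\<Sum>u\<in>{k i} \<times> ?B. \<theta> ^ fst u) = (\<Sum>u\<in>{k i} \<times> ?B. \<theta> ^ k i)"
      by (intro sum.cong) auto
    also have "\<dots> = real (card ?B) * \<theta> ^ k i" by (simp add: card_cartesian_product)
    also have "\<dots> \<le> 9 * \<theta> ^ k i"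
      using \<open>card ?B \<le> 3 * 3\<close> by (intro mult_right_mono) (auto simp: \<theta>_def)
    also have "\<theta> ^ k i = (1 / real n ^ k i) powr t"
      using n by (simp add: \<theta>_def powr_power powr_minus_divide powr_divide powr_realpow[symmetric] powr_powr mult.commute)
    also have "\<dots> \<le> (real n * \<rho> i) powr t"
      using k(2)[OF i] n t by (intro powr_mono2) (auto simp: pos_divide_le_eq ac_simps)
    also have "\<dots> = real n powr t * \<rho> i powr t"
      using \<rho>(2)[OF i] by (intro powr_mult)
    also have "\<dots> \<le> real n powr t * (g i + \<eta> / 2 ^ Suc i)"
      by (intro mult_left_mono \<rho>(4)[OF i]) simp
    finally show "(\<Sum>u\<in>{k i} \<times> ?B. \<theta> ^ fst u) \<le> 9 * real n powr t * (g i + \<eta> / 2 ^ Suc i)"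
      by (simp add: mult.assoc)
  qed
  also have "\<dots> = 9 * real n powr t * ((\<Sum>i\<in>J. g i) + (\<Sum>i\<in>J. \<eta> / 2 ^ Suc i))"
    by (simp add: sum_distrib_left sum.distrib distrib_left)
  also have "\<dots> \<le> 9 * real n powr t * (\<eta> + \<eta>)"
  proof (intro mult_left_mono add_mono)
    have "ennreal (\<Sum>i\<in>J. g i) = (\<Sum>i\<in>J. diam_pow s (U i))" using g g0 by (simp flip: sum_ennreal)
    also have "\<dots> \<le> (\<Sum>i. diam_pow s (U i))" using J(2) by (intro sum_le_suminf) auto
    also have "\<dots> \<le> ennreal \<eta>" using U(4) by simp
    finally show "(\<Sum>i\<in>J. g i) \<le> \<eta>" using \<eta> by (simp add: ennreal_le_iff)
    have sums: "(\<lambda>i. \<eta> * (1/2) ^ Suc i) sums (\<eta> * 1)" by (intro sums_mult power_half_series)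
    have "(\<Sum>i\<in>J. \<eta> * (1/2) ^ Suc i) \<le> \<eta> * 1"
      unfolding sums_unique[OF sums] using \<eta> J(2) by (intro sum_le_suminf sums_summable[OF sums]) auto
    then show "(\<Sum>i\<in>J. \<eta> / 2 ^ Suc i) \<le> \<eta>" by (simp add: power_divide)
  qed simp
  also have "\<dots> < \<epsilon>"
    using assms(4) n by (simp add: \<eta>_def)
  finally show False using cut[of K] by (simp add: \<theta>_def)
qed

lemma hausdorff_dim_ge:
  assumes "2 \<le> n" "0 < \<epsilon>" "\<And>l. \<epsilon> \<le> cut_value n (real n powr - t) l kp" "percolation_limit n kp \<noteq> {}"
  shows "ereal t \<le> hausdorff_dim (percolation_limit n kp)"
proof -
  have "t \<le> s" if "0 \<le> s" "hausdorff_measure s (percolation_limit n kp) = 0" for s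
    using hausdorff_measure_pos[OF assms(1) that(1) _ assms(2,3)] that(2) by force
  then show ?thesis using assms(4) by (auto simp: hausdorff_dim_def intro!: Inf_greatest)
qed

section \<open>Boundaries of basic open sets\<close>

definition restricted_limit ::
    "nat \<Rightarrow> (nat \<times> nat \<times> nat \<Rightarrow> bool) \<Rightarrow> nat \<Rightarrow> (nat \<times> nat) set \<Rightarrow> (real \<times> real) set" where
  "restricted_limit n kp k S =
     (\<Inter>m. \<Union>c\<in>{c \<in> kept_squares n kp (k + m). ancestor n m c \<in> S}. grid_square n (k + m) c)"

text \<open>A superset of the boundaries for all sets \<open>S\<close> of level-\<open>k\<close>
  squares at once, which leaves countably many random sets to estimate.\<close>

definition double_points :: "nat \<Rightarrow> (nat \<times> nat \<times> nat \<Rightarrow> bool) \<Rightarrow> nat \<Rightarrow> (real \<times> real) set" where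
  "double_points n kp k =
     {z. \<forall>m. \<exists>a\<in>kept_squares n kp (k + m). \<exists>b\<in>kept_squares n kp (k + m).
        ancestor n m a \<noteq> ancestor n m b \<and> z \<in> grid_square n (k + m) a \<inter> grid_square n (k + m) b}"

lemma closed_restricted_limit:
  assumes "0 < n"
  shows "closed (restricted_limit n kp k S)"
  unfolding restricted_limit_def using finite_kept_squares[OF assms]
  by (intro closed_INT ballI closed_UN compact_imp_closed compact_grid_square) auto

lemma restricted_limit_Int_subset:
  "restricted_limit n kp k S \<inter> restricted_limit n kp k (- S) \<subseteq> double_points n kp k"
proof
  fix z assume z: "z \<in> restricted_limit n kp k S \<inter> restricted_limit n kp k (- S)"
  have "\<exists>a\<in>kept_squares n kp (k + m). \<exists>b\<in>kept_squares n kp (k + m).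
      ancestor n m a \<noteq> ancestor n m b \<and> z \<in> grid_square n (k + m) a \<inter> grid_square n (k + m) b" for m
  proof -
    have *: "\<exists>c\<in>kept_squares n kp (k + m). ancestor n m c \<in> T \<and> z \<in> grid_square n (k + m) c"
      if "z \<in> restricted_limit n kp k T" for T
      using that by (auto simp: restricted_limit_def)
    obtain a b where "a \<in> kept_squares n kp (k + m)" "ancestor n m a \<in> S" "z \<in> grid_square n (k + m) a"
      and "b \<in> kept_squares n kp (k + m)" "ancestor n m b \<in> - S" "z \<in> grid_square n (k + m) b"
      using *[of S] *[of "- S"] z by blast
    then show ?thesis by (intro bexI[of _ a] bexI[of _ b]) auto
  qed
  then show "z \<in> double_points n kp k" by (simp add: double_points_def)
qed

text \<open>The squares chosen around a point at different levels need not be nested. Infinitely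
  many of them descend from \<open>S\<close> or infinitely many from its complement, and the
  ancestors of these supply all intermediate levels.\<close>

lemma restricted_limit_Un:
  assumes "0 < n"
  shows "percolation_limit n kp = restricted_limit n kp k S \<union> restricted_limit n kp k (- S)"
proof (intro equalityI subsetI)
  fix z assume z: "z \<in> percolation_limit n kp"
  have "\<exists>c\<in>kept_squares n kp (k + m). z \<in> grid_square n (k + m) c" for m
    using z by (auto simp: percolation_limit_eq[OF assms] percolation_step_def)
  then obtain c where c: "\<And>m. c m \<in> kept_squares n kp (k + m)" "\<And>m. z \<in> grid_square n (k + m) (c m)"
    by metis
  have "z \<in> restricted_limit n kp k T" if inf: "\<And>m. \<exists>l\<ge>m. ancestor n l (c l) \<in> T" for T
    unfolding restricted_limit_def
  proof
    fix m
    obtain l where l: "m \<le> l" "ancestor n l (c l) \<in> T" using inf by blast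
    then have kl: "k + l = k + m + (l - m)" by simp
    have "ancestor n (l - m) (c l) \<in> kept_squares n kp (k + m)"
      using c(1)[of l] unfolding kl by (rule ancestor_kept_squares)
    moreover have "z \<in> grid_square n (k + m) (ancestor n (l - m) (c l))"
      using c(2)[of l] unfolding kl by (rule grid_square_ancestor[OF assms])
    moreover have "ancestor n m (ancestor n (l - m) (c l)) \<in> T"
      using l by (simp add: ancestor_ancestor)
    ultimately show "z \<in> (\<Union>c\<in>{c \<in> kept_squares n kp (k + m). ancestor n m c \<in> T}. grid_square n (k + m) c)"
      by blast
  qed
  moreover have "(\<forall>m. \<exists>l\<ge>m. ancestor n l (c l) \<in> S) \<or> (\<forall>m. \<exists>l\<ge>m. ancestor n l (c l) \<in> - S)"
    by (meson ComplI nat_le_linear)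
  ultimately show "z \<in> restricted_limit n kp k S \<union> restricted_limit n kp k (- S)" by blast
next
  fix z assume "z \<in> restricted_limit n kp k S \<union> restricted_limit n kp k (- S)"
  then have step: "z \<in> percolation_step n kp (k + m)" for m
    by (auto simp: restricted_limit_def percolation_step_def)
  have "z \<in> percolation_step n kp l" for l
    using step[of l] percolation_step_antimono[OF assms, of l "k + l" kp] by auto
  then show "z \<in> percolation_limit n kp" by (simp add: percolation_limit_eq[OF assms])
qed

text \<open>The complement in the limit set of the closed part descending from \<open>- S\<close> is
  open, and its closure stays in the closed part descending from \<open>S\<close>. Hence its
  frontier lies in both parts.\<close>

lemma topological_hausdorff_dim_le:
  fixes d :: ereal
  assumes "2 \<le> n" "percolation_limit n kp \<noteq> {}"
    and dim: "\<And>k. hausdorff_dim (double_points n kp k) \<le> d - 1"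
  shows "topological_hausdorff_dim (percolation_limit n kp) \<le> d"
proof -
  let ?M = "percolation_limit n kp"
  let ?L = "restricted_limit n kp"
  have n: "0 < n" using assms(1) by simp
  define B where "B = {?M - ?L k (- S) |k S. True}"
  have ope: "openin (top_of_set ?M) (?M - ?L k S)" for k S
    using closed_restricted_limit[OF n] by (auto simp: openin_open intro!: exI[of _ "- ?L k S"])
  have fr: "hausdorff_dim (top_of_set ?M frontier_of (?M - ?L k (- S))) \<le> d - 1" for k S
  proof -
    have sub: "?M - ?L k (- S) \<subseteq> ?L k S" using restricted_limit_Un[OF n, of kp k S] by blast
    have "?L k S \<subseteq> ?M" using restricted_limit_Un[OF n, of kp k S] by blast
    then have "closedin (top_of_set ?M) (?L k S)"
      using closed_restricted_limit[OF n] by (intro closed_subset)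
    then have "top_of_set ?M closure_of (?M - ?L k (- S)) \<subseteq> ?L k S"
      using sub by (rule closure_of_minimal[rotated])
    then have "top_of_set ?M frontier_of (?M - ?L k (- S)) \<subseteq> ?L k S - (?M - ?L k (- S))"
      unfolding frontier_of_openin[OF ope] by blast
    also have "\<dots> \<subseteq> double_points n kp k"
      using \<open>?L k S \<subseteq> ?M\<close> restricted_limit_Int_subset[of n kp k S] by blast
    finally show ?thesis using dim[of k] hausdorff_dim_mono order_trans by blast
  qed
  have "\<exists>U\<in>B. z \<in> U \<and> U \<subseteq> V" if V: "openin (top_of_set ?M) V" "z \<in> V" for V z
  proof -
    obtain W where W: "open W" "V = ?M \<inter> W" using V(1) by (auto simp: openin_open)
    have z: "z \<in> ?M" "z \<in> W" using V(2) W by auto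
    obtain r where r: "0 < r" "ball z r \<subseteq> W" using W(1) z(2) openE by blast
    obtain k where "2 / r < real n ^ k" using real_arch_pow[of "real n" "2 / r"] assms(1) by auto
    then have k: "2 / real n ^ k < r" using r(1) n by (simp add: field_simps)
    \<comment> \<open>Depth 0 already excludes \<open>z\<close> from the removed part, and whatever
      remains lies in level-\<open>k\<close> squares containing \<open>z\<close>, hence within
      \<open>2 / n ^ k\<close> of it.\<close>
    define S where "S = {c. z \<in> grid_square n k c}"
    have "z \<notin> ?L k (- S)"
      by (auto simp: restricted_limit_def S_def intro!: exI[of _ 0])
    moreover have "?M - ?L k (- S) \<subseteq> V"
    proof
      fix y assume y: "y \<in> ?M - ?L k (- S)"
      then have "y \<in> ?L k S" using restricted_limit_Un[OF n, of kp k S] by blast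
      then have "y \<in> (\<Union>c\<in>{c \<in> kept_squares n kp (k + 0). ancestor n 0 c \<in> S}. grid_square n (k + 0) c)"
        unfolding restricted_limit_def by blast
      then obtain c where "y \<in> grid_square n k c" "z \<in> grid_square n k c" by (auto simp: S_def)
      then have "dist z y \<le> 2 / real n ^ k" by (intro dist_grid_square[OF n])
      then have "y \<in> ball z r" using k by simp
      then show "y \<in> V" using r W y by blast
    qed
    ultimately show ?thesis using z(1) unfolding B_def by blast
  qed
  then have "topology_basis (top_of_set ?M) B"
    unfolding topology_basis_def
  proof (intro conjI ballI allI impI)
    fix U assume "U \<in> B"
    then show "openin (top_of_set ?M) U" unfolding B_def using ope by blast
  next
    fix V assume "openin (top_of_set ?M) V" and *: "\<And>V z. openin (top_of_set ?M) V \<Longrightarrow> z \<in> V \<Longrightarrow> \<exists>U\<in>B. z \<in> U \<and> U \<subseteq> V"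
    then show "\<exists>B'\<subseteq>B. \<Union> B' = V" by (intro exI[of _ "{U \<in> B. U \<subseteq> V}"]) blast
  qed
  then show ?thesis
    using assms(2) fr unfolding topological_hausdorff_dim_def B_def by (auto intro!: Inf_lower)
qed

section \<open>Independence and self-similarity\<close>

definition coin_space :: "nat \<Rightarrow> (nat \<times> nat \<times> nat \<Rightarrow> bool) measure" where
  "coin_space n = PiM (percolation_index n) (\<lambda>_. count_space UNIV)"

text \<open>Points of the product space are extensional, while \<open>keep\<close> is arbitrary
  outside the index set. Invariance under \<open>restrict\<close> allows the same functional on
  both.\<close>

definition coin_functional :: "nat \<Rightarrow> ((nat \<times> nat \<times> nat \<Rightarrow> bool) \<Rightarrow> real) \<Rightarrow> bool" where
  "coin_functional n \<Phi> \<longleftrightarrow> \<Phi> \<in> borel_measurable (coin_space n) \<and>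
     (\<forall>kp. \<Phi> (restrict kp (percolation_index n)) = \<Phi> kp)"

lemma coin_functional_cong:
  assumes "coin_functional n \<Phi>" "\<And>x. x \<in> percolation_index n \<Longrightarrow> kp x = kp' x"
  shows "\<Phi> kp = \<Phi> kp'"
proof -
  have "restrict kp (percolation_index n) = restrict kp' (percolation_index n)"
    using assms(2) by (rule restrict_ext)
  then show ?thesis using assms(1) unfolding coin_functional_def by metis
qed

lemma descend_index:
  assumes "c \<in> children n" "x \<in> percolation_index n"
  shows "descend n c x \<in> percolation_index n"
proof -
  have *: "u * n ^ k + a < n * n ^ k" if "u < n" "a < n ^ k" for u k a
  proof -
    have "u * n ^ k + a < Suc u * n ^ k" using that by simp
    also have "\<dots> \<le> n * n ^ k" using that by (intro mult_right_mono) auto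
    finally show ?thesis .
  qed
  show ?thesis
    using assms * by (auto simp: percolation_index_def descend_def children_def)
qed

lemma first_index: "c \<in> children n \<Longrightarrow> (1, c) \<in> percolation_index n"
  by (auto simp: percolation_index_def children_def)

lemma descend_eq_imp_eq:
  assumes "descend n c x = descend n c' x'"
    and "x \<in> percolation_index n" "x' \<in> percolation_index n"
  shows "c = c'"
proof -
  obtain k a b where x: "x = (k, a, b)" by (metis prod.exhaust)
  obtain k' a' b' where x': "x' = (k', a', b')" by (metis prod.exhaust)
  show ?thesis
    using assms descend_inject[of n c k a b c' k' a' b'] by (simp add: x x' percolation_index_def)
qed

lemma descend_neq_first: "x \<in> percolation_index n \<Longrightarrow> descend n c x \<noteq> (1, c')"
  by (auto simp: percolation_index_def descend_def)

lemma coin_functional_subtree: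
  assumes "coin_functional n \<Phi>" "c \<in> children n"
  shows "coin_functional n (\<lambda>kp. \<Phi> (subtree n c kp))"
proof -
  have [measurable]: "\<Phi> \<in> borel_measurable (coin_space n)"
    using assms(1) by (simp add: coin_functional_def)
  have [measurable]: "(\<lambda>kp. \<lambda>x\<in>percolation_index n. kp (descend n c x)) \<in> coin_space n \<rightarrow>\<^sub>M coin_space n"
    unfolding coin_space_def using descend_index[OF assms(2)]
    by (intro measurable_restrict measurable_component_singleton) auto
  have eq: "\<Phi> (subtree n c kp) = \<Phi> (\<lambda>x\<in>percolation_index n. kp (descend n c x))" for kp
    by (rule coin_functional_cong[OF assms(1)]) (simp add: subtree_def)
  have "(\<lambda>kp. \<Phi> (subtree n c kp)) \<in> borel_measurable (coin_space n)"
    unfolding eq by measurable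
  moreover have "\<Phi> (subtree n c (restrict kp (percolation_index n))) = \<Phi> (subtree n c kp)" for kp
    by (rule coin_functional_cong[OF assms(1)]) (simp add: subtree_def descend_index[OF assms(2)])
  ultimately show ?thesis by (simp add: coin_functional_def)
qed

lemma coin_functional_child:
  assumes "coin_functional n \<Phi>" "c \<in> children n"
  shows "coin_functional n (\<lambda>kp. if kp (1, c) then \<Phi> (subtree n c kp) else 0)"
proof -
  have [measurable]: "(\<lambda>kp. \<Phi> (subtree n c kp)) \<in> borel_measurable (coin_space n)"
    using coin_functional_subtree[OF assms] by (simp add: coin_functional_def)
  have [measurable]: "(\<lambda>kp. kp (1, c)) \<in> coin_space n \<rightarrow>\<^sub>M count_space UNIV"
    unfolding coin_space_def by (rule measurable_component_singleton[OF first_index[OF assms(2)]])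
  have "(\<lambda>kp. if kp (1, c) then \<Phi> (subtree n c kp) else 0) \<in> borel_measurable (coin_space n)"
    by measurable
  then show ?thesis
    using coin_functional_subtree[OF assms] first_index[OF assms(2)]
    by (simp add: coin_functional_def)
qed

lemma coin_functional_compose:
  assumes "coin_functional n \<Phi>" "g \<in> borel_measurable borel"
  shows "coin_functional n (\<lambda>kp. g (\<Phi> kp))"
  using assms measurable_compose[of \<Phi> "coin_space n" borel g borel]
  by (simp add: coin_functional_def)

lemma coin_functional_sum:
  assumes "\<And>c. c \<in> S \<Longrightarrow> coin_functional n (\<Phi> c)"
  shows "coin_functional n (\<lambda>kp. \<Sum>c\<in>S. \<Phi> c kp)"
  using assms by (auto simp: coin_functional_def intro!: sum.cong borel_measurable_sum)

lemma coin_functional_cut_value: "coin_functional n (cut_value n \<theta> l)"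
proof (induction l)
  case 0
  then show ?case by (simp add: coin_functional_def)
next
  case (Suc l)
  have "coin_functional n (\<lambda>kp. \<Sum>c\<in>children n. if kp (1, c) then cut_value n \<theta> l (subtree n c kp) else 0)"
    by (intro coin_functional_sum coin_functional_child Suc.IH)
  then have "coin_functional n (\<lambda>kp. (\<lambda>x. min 1 (\<theta> * x))
      (\<Sum>c\<in>children n. if kp (1, c) then cut_value n \<theta> l (subtree n c kp) else 0))"
    by (rule coin_functional_compose) measurable
  then show ?case by (simp only: cut_value.simps(2)[abs_def])
qed

lemma coin_functional_alive:
  assumes "0 < n"
  shows "coin_functional n (\<lambda>kp. of_bool (kept_squares n kp k \<noteq> {}))"
proof (induction k)
  case (Suc k)
  let ?g = "\<lambda>kp c. if kp (1, c) then of_bool (kept_squares n (subtree n c kp) k \<noteq> {}) else (0::real)"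
  \<comment> \<open>Survival is a truncated sum over the children, so the closure properties of coin
    functionals apply.\<close>
  have eq: "of_bool (kept_squares n kp (Suc k) \<noteq> {}) = min 1 (\<Sum>c\<in>children n. ?g kp c)" for kp
  proof (cases "kept_squares n kp (Suc k) \<noteq> {}")
    case True
    then obtain c where c: "c \<in> children n" "kp (1, c)" "kept_squares n (subtree n c kp) k \<noteq> {}"
      using kept_squares_Suc_eq_empty_iff[OF assms, of kp k] by blast
    then have "?g kp c \<le> (\<Sum>c\<in>children n. ?g kp c)" by (intro member_le_sum) auto
    then show ?thesis using True c by (simp del: kept_squares.simps)
  next
    case False
    then have "?g kp c = 0" if "c \<in> children n" for c
      using kept_squares_Suc_eq_empty_iff[OF assms, of kp k] that by auto
    then have "(\<Sum>c\<in>children n. ?g kp c) = 0" by (intro sum.neutral) blast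
    then show ?thesis using False by (simp only:) simp
  qed
  have "coin_functional n (\<lambda>kp. \<Sum>c\<in>children n. ?g kp c)"
    by (intro coin_functional_sum coin_functional_child Suc.IH)
  then show ?case unfolding eq by (rule coin_functional_compose) measurable
qed (simp add: coin_functional_def)

section \<open>Trees with positive cutset weight\<close>

text \<open>Positivity of the infimum over all depths; the countably many thresholds keep the event
  measurable.\<close>

definition positive_cut :: "nat \<Rightarrow> real \<Rightarrow> (nat \<times> nat \<times> nat \<Rightarrow> bool) \<Rightarrow> bool" where
  "positive_cut n \<theta> kp \<longleftrightarrow> (\<exists>m. \<forall>l. 1 / Suc m \<le> cut_value n \<theta> l kp)"

lemma coin_functional_positive_cut: "coin_functional n (\<lambda>kp. of_bool (positive_cut n \<theta> kp))"
proof -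
  have [measurable]: "cut_value n \<theta> l \<in> borel_measurable (coin_space n)" for l
    using coin_functional_cut_value by (simp add: coin_functional_def)
  have "(\<lambda>kp. of_bool (positive_cut n \<theta> kp)::real) \<in> borel_measurable (coin_space n)"
    unfolding positive_cut_def by measurable
  then show ?thesis
    using coin_functional_cut_value[of n \<theta>] by (simp add: coin_functional_def positive_cut_def)
qed

lemma positive_cutI:
  assumes "0 < \<epsilon>" "\<And>l. \<epsilon> \<le> cut_value n \<theta> l kp"
  shows "positive_cut n \<theta> kp"
proof -
  obtain m where "1 / Suc m < \<epsilon>" using reals_Archimedean[OF assms(1)] by (auto simp: inverse_eq_divide)
  then show ?thesis unfolding positive_cut_def
    using assms(2) by (meson less_eq_real_def order_trans)
qed

text \<open>A lower bound for the child, multiplied by \<theta>, is one for the parent. This is the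
  source of the subsolution property of the probability of failure.\<close>

lemma positive_cut_subtree:
  assumes "0 < \<theta>" "\<theta> \<le> 1" "c \<in> children n" "kp (1, c)" "positive_cut n \<theta> (subtree n c kp)"
  shows "positive_cut n \<theta> kp"
proof -
  obtain m where m: "\<And>l. 1 / Suc m \<le> cut_value n \<theta> l (subtree n c kp)"
    using assms(5) by (auto simp: positive_cut_def)
  have *: "\<theta> * (1 / Suc m) \<le> cut_value n \<theta> (Suc l) kp" for l
    using cut_value_Suc_ge_child[where kp = kp and l = l, OF less_imp_le[OF assms(1)] assms(2-4)]
      mult_left_mono[OF m[of l] less_imp_le[OF assms(1)]] by linarith
  have "\<theta> * (1 / Suc m) \<le> cut_value n \<theta> l kp" for l
  proof (cases l)
    case 0
    then show ?thesis using assms(1,2) by (simp add: divide_le_eq)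
  next
    case (Suc l')
    then show ?thesis using * by blast
  qed
  then show ?thesis using assms(1) by (intro positive_cutI[of "\<theta> * (1 / Suc m)"]) auto
qed

text \<open>The empty set is a cutset of an extinct tree.\<close>

lemma not_positive_cut:
  assumes "0 < n" "0 \<le> \<theta>" "kept_squares n kp k = {}"
  shows "\<not> positive_cut n \<theta> kp"
proof
  assume "positive_cut n \<theta> kp"
  then obtain m where "1 / Suc m \<le> cut_value n \<theta> k kp" by (auto simp: positive_cut_def)
  then have "0 < cut_value n \<theta> k kp" by (meson less_le_trans of_nat_0_less_iff zero_less_Suc zero_less_divide_1_iff)
  moreover have "cut_value n \<theta> k kp \<le> 0"
    using cut_value_le_cutset[of n \<theta> "{}" kp k] assms by simp
  ultimately show False by simp
qed

text \<open>
  As no summand exceeds \<open>\<theta> < 1\<close>, truncation at 1 loses mass only if at least two summands are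
  positive; for independent summands the loss is thus quadratic in the mean.
\<close>

lemma truncated_sum_ge:
  fixes a :: "'a \<Rightarrow> real"
  assumes "finite S" "\<theta> < 1" "\<And>c. c \<in> S \<Longrightarrow> 0 \<le> a c" "\<And>c. c \<in> S \<Longrightarrow> a c \<le> \<theta>"
  shows "sum a S - (\<Sum>c\<in>S. \<Sum>d\<in>S - {c}. a c * a d) / (1 - \<theta>) \<le> min 1 (sum a S)"
proof -
  define y where "y = sum a S"
  define z where "z = (\<Sum>c\<in>S. \<Sum>d\<in>S - {c}. a c * a d)"
  have y0: "0 \<le> y" unfolding y_def using assms by (intro sum_nonneg)
  have z0: "0 \<le> z" unfolding z_def using assms by (intro sum_nonneg mult_nonneg_nonneg) auto
  have "y * y = (\<Sum>c\<in>S. a c * a c) + z"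
    unfolding y_def z_def sum_product
    using assms(1) by (simp add: sum.distrib[symmetric] sum.remove[of S])
  \<comment> \<open>The diagonal part of \<open>y * y\<close> is at most
    \<open>\<theta> * y\<close>, so the off-diagonal part \<open>z\<close> is at least
    \<open>y * (y - \<theta>)\<close>, which for \<open>y > 1\<close> dominates
    \<open>(y - 1) * (1 - \<theta>)\<close>.\<close>
  moreover have "(\<Sum>c\<in>S. a c * a c) \<le> y * \<theta>"
    unfolding y_def sum_distrib_right using assms by (intro sum_mono mult_left_mono)
  ultimately have z: "y * (y - \<theta>) \<le> z" by (simp add: algebra_simps)
  have "y - z / (1 - \<theta>) \<le> min 1 y"
  proof (cases "y \<le> 1")
    case True
    then show ?thesis using z0 assms(2) by simp
  next
    case False
    then have "(y - 1) * (1 - \<theta>) \<le> y * (y - \<theta>)"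
      using assms(2) by (intro mult_mono) auto
    then have "y - 1 \<le> z / (1 - \<theta>)"
      using z assms(2) by (simp add: le_divide_eq)
    then show ?thesis using False by simp
  qed
  then show ?thesis unfolding y_def z_def .
qed

lemma (in prob_space) indep_vars_reindex:
  assumes "inj_on f I" "indep_vars (\<lambda>_. N) X (f ` I)"
  shows "indep_vars (\<lambda>_. N) (\<lambda>i. X (f i)) I"
proof -
  have "prob (\<Inter>j\<in>J. A j) = (\<Prod>j\<in>J. prob (A j))"
    if J: "J \<subseteq> I" "J \<noteq> {}" "finite J"
      and A: "\<forall>j\<in>J. A j \<in> {X (f j) -` B \<inter> space M |B. B \<in> sets N}" for J A
  proof -
    have inj: "inj_on f J" using assms(1) J(1) by (rule inj_on_subset)
    obtain B where B: "\<And>j. j \<in> J \<Longrightarrow> B j \<in> sets N \<and> A j = X (f j) -` B j \<inter> space M"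
      using A by (simp add: Ball_def) metis
    define B' where "B' i = B (the_inv_into J f i)" for i
    have B': "B' (f j) = B j" if "j \<in> J" for j
      using that inj by (simp add: B'_def the_inv_into_f_f)
    have "prob (\<Inter>i\<in>f ` J. X i -` B' i \<inter> space M) = (\<Prod>i\<in>f ` J. prob (X i -` B' i \<inter> space M))"
      using J B B' by (intro indep_varsD[OF assms(2)]) auto
    also have "(\<Inter>i\<in>f ` J. X i -` B' i \<inter> space M) = (\<Inter>j\<in>J. A j)"
      using B B' by simp
    also have "(\<Prod>i\<in>f ` J. prob (X i -` B' i \<inter> space M)) = (\<Prod>j\<in>J. prob (A j))"
      using B B' inj by (simp add: prod.reindex)
    finally show ?thesis .
  qed
  then show ?thesis
    using assms(2) unfolding indep_vars_def2 indep_sets_def by (auto simp: Pi_iff)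
qed

lemma (in prob_space) integrable_bounded:
  assumes "f \<in> borel_measurable M" "\<And>\<omega>. 0 \<le> f \<omega>" "\<And>\<omega>. f \<omega> \<le> (1::real)"
  shows "integrable M f"
  by (rule integrable_const_bound[of _ 1]) (use assms in auto)

section \<open>Law of the decisions and independence of subtrees\<close>

text \<open>Stated for any family of decisions, so that those below a child form another instance
  over the same \<open>P\<close>.\<close>

locale percolation = prob_space P for P :: "'w measure" +
  fixes p :: real and n :: nat and keep :: "nat \<times> nat \<times> nat \<Rightarrow> 'w \<Rightarrow> bool"
  assumes n_ge_2: "2 \<le> n"
    and indep_keep: "indep_vars (\<lambda>_. count_space UNIV) keep (percolation_index n)"
    and prob_keep: "\<And>c. c \<in> percolation_index n \<Longrightarrow> prob {\<omega> \<in> space P. keep c \<omega>} = p"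
begin

abbreviation coins :: "'w \<Rightarrow> nat \<times> nat \<times> nat \<Rightarrow> bool" where
  "coins \<omega> \<equiv> (\<lambda>c. keep c \<omega>)"

lemma n_pos: "0 < n" using n_ge_2 by simp

lemma zero_child: "(0, 0) \<in> children n" using n_pos by (simp add: children_def)

lemma p_ge_0: "0 \<le> p" and p_le_1: "p \<le> 1"
  using prob_keep[OF first_index[OF zero_child]] measure_nonneg prob_le_1 by metis+

lemma measurable_keep: "c \<in> percolation_index n \<Longrightarrow> keep c \<in> P \<rightarrow>\<^sub>M count_space UNIV"
  using indep_keep by (simp add: indep_vars_def)

lemma measurable_coins: "(\<lambda>\<omega>. restrict (coins \<omega>) (percolation_index n)) \<in> P \<rightarrow>\<^sub>M coin_space n"
  unfolding coin_space_def by (intro measurable_restrict measurable_keep)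

lemma measurable_functional:
  assumes "coin_functional n \<Phi>"
  shows "(\<lambda>\<omega>. \<Phi> (coins \<omega>)) \<in> borel_measurable P"
proof -
  have "(\<lambda>\<omega>. \<Phi> (restrict (coins \<omega>) (percolation_index n))) \<in> borel_measurable P"
    using assms by (intro measurable_compose[OF measurable_coins]) (simp add: coin_functional_def)
  then show ?thesis using assms by (simp add: coin_functional_def)
qed

lemma distr_keep:
  assumes "c \<in> percolation_index n"
  shows "distr P (count_space UNIV) (keep c) = measure_pmf (bernoulli_pmf p)"
proof (rule measure_eqI_finite[where A = UNIV])
  note [measurable] = measurable_keep[OF assms]
  fix b :: bool
  have T: "prob (keep c -` {True} \<inter> space P) = p"
    using prob_keep[OF assms] by (simp add: vimage_def Int_def conj_commute)
  have "prob (keep c -` {False} \<inter> space P) = 1 - prob (keep c -` {True} \<inter> space P)"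
    by (subst prob_compl[symmetric]) (auto intro!: arg_cong[where f=prob])
  then show "emeasure (distr P (count_space UNIV) (keep c)) {b} = emeasure (measure_pmf (bernoulli_pmf p)) {b}"
    using T p_ge_0 p_le_1
    by (cases b) (simp_all add: emeasure_distr emeasure_pmf_single emeasure_eq_measure)
qed simp_all

lemma distr_coins:
  "distr P (coin_space n) (\<lambda>\<omega>. restrict (coins \<omega>) (percolation_index n)) =
     PiM (percolation_index n) (\<lambda>_. measure_pmf (bernoulli_pmf p))"
proof -
  have "percolation_index n \<noteq> {}" using first_index[OF zero_child] by auto
  then have "distr P (PiM (percolation_index n) (\<lambda>_. count_space UNIV)) (\<lambda>\<omega>. restrict (coins \<omega>) (percolation_index n)) =
     PiM (percolation_index n) (\<lambda>c. distr P (count_space UNIV) (keep c))"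
    using indep_vars_iff_distr_eq_PiM'[where I="percolation_index n" and M'="\<lambda>_. count_space UNIV" and X=keep]
      measurable_keep indep_keep by blast
  then show ?thesis unfolding coin_space_def by (simp add: distr_keep cong: PiM_cong)
qed

text \<open>The restricted decisions have the Bernoulli product law. The right-hand side does not
  mention \<open>keep\<close>, hence is common to all instances of the locale.\<close>

lemma expectation_functional:
  assumes "coin_functional n \<Phi>"
  shows "expectation (\<lambda>\<omega>. \<Phi> (coins \<omega>)) =
    (\<integral>x. \<Phi> x \<partial>PiM (percolation_index n) (\<lambda>_. measure_pmf (bernoulli_pmf p)))"
proof -
  have "expectation (\<lambda>\<omega>. \<Phi> (restrict (coins \<omega>) (percolation_index n))) =
      (\<integral>x. \<Phi> x \<partial>distr P (coin_space n) (\<lambda>\<omega>. restrict (coins \<omega>) (percolation_index n)))"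
    using assms by (intro integral_distr[symmetric] measurable_coins) (simp add: coin_functional_def)
  then show ?thesis using assms by (simp add: distr_coins coin_functional_def)
qed

lemma percolation_subtree:
  assumes "c \<in> children n"
  shows "percolation P p n (\<lambda>x. keep (descend n c x))"
proof unfold_locales
  have "descend n c ` percolation_index n \<subseteq> percolation_index n"
    using descend_index[OF assms] by auto
  then have "indep_vars (\<lambda>_. count_space UNIV) keep (descend n c ` percolation_index n)"
    by (rule indep_vars_subset[OF indep_keep])
  from indep_vars_reindex[OF inj_on_descend this]
  show "indep_vars (\<lambda>_. count_space UNIV) (\<lambda>x. keep (descend n c x)) (percolation_index n)"
    by (simp add: comp_def)
qed (simp_all add: n_ge_2 prob_keep descend_index[OF assms])

text \<open>Self-similarity in law: both sides are the same integral over the product space.\<close>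

lemma expectation_subtree:
  assumes "coin_functional n \<Phi>" "c \<in> children n"
  shows "expectation (\<lambda>\<omega>. \<Phi> (subtree n c (coins \<omega>))) = expectation (\<lambda>\<omega>. \<Phi> (coins \<omega>))"
  using percolation.expectation_functional[OF percolation_subtree[OF assms(2)] assms(1)]
  by (simp add: expectation_functional[OF assms(1)] subtree_def)

definition child_value ::
    "((nat \<times> nat \<times> nat \<Rightarrow> bool) \<Rightarrow> real) \<Rightarrow> nat \<times> nat \<Rightarrow> 'w \<Rightarrow> real" where
  "child_value \<Phi> c \<omega> = (if keep (1, c) \<omega> then \<Phi> (subtree n c (coins \<omega>)) else 0)"

lemma measurable_child_value:
  assumes "coin_functional n \<Phi>" "c \<in> children n"
  shows "child_value \<Phi> c \<in> borel_measurable P"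
  using measurable_functional[OF coin_functional_child[OF assms]] by (simp add: child_value_def[abs_def])

lemma indep_child_value:
  assumes "coin_functional n \<Phi>"
  shows "indep_vars (\<lambda>_. borel) (child_value \<Phi>) (children n)"
proof -
  let ?I = "percolation_index n"
  \<comment> \<open>The decisions that determine the value of child \<open>c\<close>: its own and
    those of its subtree. Blocks of different children are disjoint.\<close>
  define K where "K c = insert (1, c) (descend n c ` ?I)" for c
  define Y where "Y c x = (if x (1, c) then \<Phi> (\<lambda>i\<in>?I. x (descend n c i)) else 0)" for c x
  have dis: "disjoint_family_on K (children n)"
  proof (unfold disjoint_family_on_def, intro ballI impI)
    fix c d :: "nat \<times> nat" assume "c \<noteq> d"
    then show "K c \<inter> K d = {}"
      using descend_eq_imp_eq[of n c _ d] descend_neq_first[of _ n c d] descend_neq_first[of _ n d c]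
      by (fastforce simp: K_def)
  qed
  have K: "K c \<subseteq> ?I" if "c \<in> children n" for c
    unfolding K_def using descend_index[OF that] first_index[OF that] by blast
  have Y: "Y c \<in> borel_measurable (PiM (K c) (\<lambda>_. count_space UNIV))" for c
  proof -
    have [measurable]: "(\<lambda>x. x (1, c)) \<in> PiM (K c) (\<lambda>_. count_space UNIV) \<rightarrow>\<^sub>M count_space UNIV"
      by (rule measurable_component_singleton) (simp add: K_def)
    have [measurable]: "(\<lambda>x. \<lambda>i\<in>?I. x (descend n c i)) \<in> PiM (K c) (\<lambda>_. count_space UNIV) \<rightarrow>\<^sub>M coin_space n"
      unfolding coin_space_def
      by (intro measurable_restrict measurable_component_singleton) (simp add: K_def)
    have [measurable]: "\<Phi> \<in> borel_measurable (coin_space n)"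
      using assms by (simp add: coin_functional_def)
    show ?thesis unfolding Y_def by measurable
  qed
  have "indep_vars (\<lambda>_. borel) (\<lambda>c \<omega>. Y c (restrict (coins \<omega>) (K c))) (children n)"
    by (rule indep_vars_compose2[OF indep_vars_restrict[OF indep_keep K dis] Y])
  also have "?this \<longleftrightarrow> ?thesis"
  proof (intro indep_vars_cong refl ext)
    fix c :: "nat \<times> nat" and \<omega>
    have "\<Phi> (\<lambda>i\<in>?I. restrict (coins \<omega>) (K c) (descend n c i)) = \<Phi> (subtree n c (coins \<omega>))"
      by (rule coin_functional_cong[OF assms]) (simp add: K_def subtree_def)
    then show "Y c (restrict (coins \<omega>) (K c)) = child_value \<Phi> c \<omega>"
      by (simp add: Y_def child_value_def K_def)
  qed
  finally show ?thesis .
qed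

text \<open>The decision on \<open>c\<close> is independent of those strictly below it; the former
  contributes \<open>p\<close>, the latter an expectation known by self-similarity.\<close>

lemma expectation_child_value:
  assumes "coin_functional n \<Phi>" "\<And>kp. 0 \<le> \<Phi> kp" "\<And>kp. \<Phi> kp \<le> 1" "c \<in> children n"
  shows "expectation (child_value \<Phi> c) = p * expectation (\<lambda>\<omega>. \<Phi> (coins \<omega>))"
proof -
  let ?I = "percolation_index n"
  let ?A = "{(1, c)}" and ?B = "descend n c ` ?I"
  let ?f = "\<lambda>x. of_bool (x (1, c)) :: real" and ?g = "\<lambda>x. \<Phi> (\<lambda>i\<in>?I. x (descend n c i))"
  have [measurable]: "\<Phi> \<in> borel_measurable (coin_space n)"
    using assms by (simp add: coin_functional_def)
  have f: "?f \<in> borel_measurable (PiM ?A (\<lambda>_. count_space UNIV))"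
  proof -
    have [measurable]: "(\<lambda>x. x (1, c)) \<in> PiM ?A (\<lambda>_. count_space UNIV) \<rightarrow>\<^sub>M count_space UNIV"
      by (rule measurable_component_singleton) simp
    show ?thesis by measurable
  qed
  have g: "?g \<in> borel_measurable (PiM ?B (\<lambda>_. count_space UNIV))"
  proof -
    have [measurable]: "(\<lambda>x. \<lambda>i\<in>?I. x (descend n c i)) \<in> PiM ?B (\<lambda>_. count_space UNIV) \<rightarrow>\<^sub>M coin_space n"
      unfolding coin_space_def
      by (intro measurable_restrict measurable_component_singleton) simp
    show ?thesis by measurable
  qed
  have notin: "(1, c) \<notin> ?B" by (metis descend_neq_first imageE)
  have "indep_var (PiM ?A (\<lambda>_. count_space UNIV)) (\<lambda>\<omega>. restrict (coins \<omega>) ?A)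
      (PiM ?B (\<lambda>_. count_space UNIV)) (\<lambda>\<omega>. restrict (coins \<omega>) ?B)"
    using first_index[OF assms(4)] descend_index[OF assms(4)] notin
    by (intro indep_var_restrict[OF indep_keep]) auto
  from indep_var_compose[OF this f g]
  have ind: "indep_var borel (\<lambda>\<omega>. ?f (restrict (coins \<omega>) ?A)) borel (\<lambda>\<omega>. ?g (restrict (coins \<omega>) ?B))"
    by (simp add: comp_def)
  have eq: "?g (restrict (coins \<omega>) ?B) = \<Phi> (subtree n c (coins \<omega>))" for \<omega>
    by (rule coin_functional_cong[OF assms(1)]) (simp add: subtree_def)
  have ind: "indep_var borel (\<lambda>\<omega>. of_bool (keep (1, c) \<omega>)) borel (\<lambda>\<omega>. \<Phi> (subtree n c (coins \<omega>)))"
    using ind unfolding eq by simp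
  have k: "(\<lambda>\<omega>. of_bool (keep (1, c) \<omega>) :: real) \<in> borel_measurable P"
    using measurable_keep[OF first_index[OF assms(4)]] by measurable
  have "expectation (child_value \<Phi> c) = expectation (\<lambda>\<omega>. of_bool (keep (1, c) \<omega>) * \<Phi> (subtree n c (coins \<omega>)))"
    by (intro Bochner_Integration.integral_cong) (auto simp: child_value_def)
  also have "\<dots> = expectation (\<lambda>\<omega>. of_bool (keep (1, c) \<omega>)) * expectation (\<lambda>\<omega>. \<Phi> (subtree n c (coins \<omega>)))"
    using assms(2,3) k measurable_functional[OF coin_functional_subtree[OF assms(1,4)]]
    by (intro indep_var_lebesgue_integral ind integrable_bounded) auto
  also have "expectation (\<lambda>\<omega>. of_bool (keep (1, c) \<omega>)) = expectation (indicator {\<omega>\<in>space P. keep (1, c) \<omega>})"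
    by (intro Bochner_Integration.integral_cong) (auto simp: indicator_def)
  also have "\<dots> = p"
    using prob_keep[OF first_index[OF assms(4)]] by (simp add: Int_def conj_commute)
  finally show ?thesis by (simp add: expectation_subtree[OF assms(1,4)])
qed

end

section \<open>Survival\<close>

text \<open>Strict convexity of the generating function \<open>f x = (1 - p * (1 - x)) ^ N\<close>.
  As \<open>f 1 = 1\<close>, the hypotheses give a chord slope at least 1 on \<open>[q, r]\<close>
  and at most 1 on \<open>[r, 1]\<close>, but slopes increase strictly. Both slopes appear as
  \<open>p\<close> times a sum of \<open>N\<close> monomials.\<close>

lemma power_fixed_point_unique:
  fixes p q r :: real
  assumes "0 < p" "p \<le> 1" "2 \<le> N" "0 \<le> q" "q < r" "r < 1"
    and "(1 - p * (1 - q)) ^ N = q" "r \<le> (1 - p * (1 - r)) ^ N"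
  shows False
proof -
  define y where "y = 1 - p * (1 - q)"
  define z where "z = 1 - p * (1 - r)"
  have y: "0 \<le> y" "y < z" and z: "0 < z" "z < 1"
  proof -
    have "p * (1 - q) \<le> 1 * 1" using assms by (intro mult_mono) auto
    then show "0 \<le> y" by (simp add: y_def)
    show "y < z" using assms by (simp add: y_def z_def)
    then show "0 < z" using \<open>0 \<le> y\<close> by simp
    show "z < 1" using assms by (simp add: z_def)
  qed
  have "p * (1 - r) * (\<Sum>i<N. z ^ i) = (1 - z) * (\<Sum>i<N. z ^ i)"
    by (simp add: z_def)
  also have "\<dots> = 1 - z ^ N" by (rule one_diff_power_eq[symmetric])
  also have "\<dots> \<le> 1 - r" using assms(8) by (simp add: z_def)
  finally have "p * (\<Sum>i<N. z ^ i) \<le> 1" using assms(6) by (simp add: mult.assoc mult.left_commute)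
  have "r - q \<le> z ^ N - y ^ N" using assms(7,8) by (simp add: y_def z_def)
  also have "\<dots> = (z - y) * (\<Sum>i<N. y ^ (N - Suc i) * z ^ i)" by (rule power_diff_sumr2)
  also have "\<dots> = p * (r - q) * (\<Sum>i<N. y ^ (N - Suc i) * z ^ i)"
    by (simp add: y_def z_def algebra_simps)
  finally have "1 \<le> p * (\<Sum>i<N. y ^ (N - Suc i) * z ^ i)" using assms(5) by (simp add: mult.assoc mult.left_commute)
  also have "\<dots> < p * (\<Sum>i<N. z ^ i)"
  proof (intro mult_strict_left_mono assms sum_strict_mono_ex1)
    show "\<forall>i\<in>{..<N}. y ^ (N - Suc i) * z ^ i \<le> z ^ i"
      using y z by (auto intro!: mult_left_le_one_le power_le_one)
    \<comment> \<open>The strict term is \<open>i = 0\<close>, where the exponent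
      \<open>N - 1\<close> is positive because \<open>2 \<le> N\<close>.\<close>
    have "y ^ (N - Suc 0) * z ^ 0 < z ^ 0"
      using y z assms(3) by (simp add: power_strict_decreasing power_less_one_iff)
    then show "\<exists>i\<in>{..<N}. y ^ (N - Suc i) * z ^ i < z ^ i" using assms(3) by (intro bexI[of _ 0]) auto
  qed simp
  finally show False using \<open>p * (\<Sum>i<N. z ^ i) \<le> 1\<close> by simp
qed

text \<open>The chord of the generating function from \<open>q\<close> to 1 would have slope 1, but
  its slope is strictly below the derivative \<open>N * p\<close> at 1.\<close>

lemma power_fixed_point_subcritical:
  fixes p q :: real
  assumes "0 < p" "p \<le> 1" "2 \<le> N" "0 \<le> q" "q < 1" "real N * p \<le> 1"
    and "(1 - p * (1 - q)) ^ N = q"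
  shows False
proof -
  define y where "y = 1 - p * (1 - q)"
  have y: "0 \<le> y" "y < 1"
  proof -
    have "p * (1 - q) \<le> 1 * 1" using assms by (intro mult_mono) auto
    then show "0 \<le> y" by (simp add: y_def)
    show "y < 1" using assms by (simp add: y_def)
  qed
  have "1 - q = 1 - y ^ N" using assms(7) by (simp add: y_def)
  also have "\<dots> = p * (1 - q) * (\<Sum>i<N. y ^ i)"
    by (simp add: one_diff_power_eq y_def)
  finally have "1 = p * (\<Sum>i<N. y ^ i)" using assms(5) by (simp add: mult.assoc mult.left_commute)
  also have "\<dots> < p * (\<Sum>i<N. 1)"
  proof (intro mult_strict_left_mono assms sum_strict_mono_ex1)
    show "\<forall>i\<in>{..<N}. y ^ i \<le> 1" using y by (auto intro: power_le_one)
    show "\<exists>i\<in>{..<N}. y ^ i < 1" using assms(3) y by (intro bexI[of _ 1]) auto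
  qed simp
  finally show False using assms(6) by (simp add: mult.commute)
qed

context percolation begin

lemma children_nonempty: "children n \<noteq> {}"
  using zero_child by blast

lemma events_functional:
  assumes "coin_functional n (\<lambda>kp. of_bool (Q kp))"
  shows "{\<omega> \<in> space P. Q (coins \<omega>)} \<in> events"
proof -
  note [measurable] = measurable_functional[OF assms]
  have "{\<omega> \<in> space P. of_bool (Q (coins \<omega>)) = (1::real)} \<in> events" by measurable
  then show ?thesis by simp
qed

lemma expectation_of_bool:
  assumes "coin_functional n (\<lambda>kp. of_bool (Q kp))"
  shows "expectation (\<lambda>\<omega>. of_bool (Q (coins \<omega>))) = prob {\<omega> \<in> space P. Q (coins \<omega>)}"
proof -
  have "expectation (\<lambda>\<omega>. of_bool (Q (coins \<omega>))) = expectation (indicator {\<omega> \<in> space P. Q (coins \<omega>)})"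
    by (intro Bochner_Integration.integral_cong) (auto simp: indicator_def)
  also have "\<dots> = prob {\<omega> \<in> space P. Q (coins \<omega>)}"
    using events_functional[OF assms] by simp
  finally show ?thesis .
qed

text \<open>The product of 1 minus the child values is the indicator of the event, and independence
  factors its expectation. \<open>Q\<close> will be survival to a given depth as well as
  \<open>positive_cut\<close>.\<close>

lemma prob_no_child:
  assumes "coin_functional n (\<lambda>kp. of_bool (Q kp))"
  shows "prob {\<omega> \<in> space P. \<forall>c\<in>children n. \<not> (keep (1, c) \<omega> \<and> Q (subtree n c (coins \<omega>)))} =
    (1 - p * prob {\<omega> \<in> space P. Q (coins \<omega>)}) ^ n\<^sup>2"
proof -
  let ?v = "child_value (\<lambda>kp. of_bool (Q kp))"
  have int: "integrable P (?v c)" if "c \<in> children n" for c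
    using measurable_child_value[OF assms that] by (intro integrable_bounded) (auto simp: child_value_def)
  have "expectation (\<lambda>\<omega>. \<Prod>c\<in>children n. 1 - ?v c \<omega>) = (\<Prod>c\<in>children n. expectation (\<lambda>\<omega>. 1 - ?v c \<omega>))"
    using int
    by (intro indep_vars_lebesgue_integral Bochner_Integration.integrable_diff
        indep_vars_compose2[OF indep_child_value[OF assms], where Y = "\<lambda>_ x. 1 - x"]) (auto simp: children_nonempty)
  also have "\<dots> = (\<Prod>c\<in>children n. 1 - p * prob {\<omega> \<in> space P. Q (coins \<omega>)})"
    using int by (intro prod.cong refl)
      (simp add: prob_space expectation_child_value[OF assms] expectation_of_bool[OF assms])
  finally have "expectation (\<lambda>\<omega>. \<Prod>c\<in>children n. 1 - ?v c \<omega>) = (1 - p * prob {\<omega> \<in> space P. Q (coins \<omega>)}) ^ n\<^sup>2"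
    by simp
  moreover have "(\<Prod>c\<in>children n. 1 - ?v c \<omega>) =
      indicator {\<omega> \<in> space P. \<forall>c\<in>children n. \<not> (keep (1, c) \<omega> \<and> Q (subtree n c (coins \<omega>)))} \<omega>"
    if "\<omega> \<in> space P" for \<omega>
  proof (cases "\<forall>c\<in>children n. \<not> (keep (1, c) \<omega> \<and> Q (subtree n c (coins \<omega>)))")
    case True
    then have "(\<Prod>c\<in>children n. 1 - ?v c \<omega>) = (\<Prod>c\<in>children n. 1)"
      by (intro prod.cong) (auto simp: child_value_def)
    then show ?thesis using True that by simp
  next
    case False
    then obtain c where "c \<in> children n" "?v c \<omega> = 1" by (auto simp: child_value_def)
    then have "(\<Prod>c\<in>children n. 1 - ?v c \<omega>) = 0" by (intro prod_zero) auto
    then show ?thesis using False by (auto simp: indicator_def)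
  qed
  then have "expectation (\<lambda>\<omega>. \<Prod>c\<in>children n. 1 - ?v c \<omega>) =
      expectation (indicator {\<omega> \<in> space P. \<forall>c\<in>children n. \<not> (keep (1, c) \<omega> \<and> Q (subtree n c (coins \<omega>)))})"
    by (intro Bochner_Integration.integral_cong) auto
  moreover have "\<dots> = prob {\<omega> \<in> space P. \<forall>c\<in>children n. \<not> (keep (1, c) \<omega> \<and> Q (subtree n c (coins \<omega>)))}"
  proof -
    have "{\<omega> \<in> space P. \<forall>c\<in>children n. \<not> (keep (1, c) \<omega> \<and> Q (subtree n c (coins \<omega>)))} =
      {\<omega> \<in> space P. \<forall>c\<in>children n. ?v c \<omega> = 0}" by (auto simp: child_value_def)
    moreover have "\<dots> \<in> events"
      using measurable_child_value[OF assms] by (intro sets.sets_Collect_finite_All' borel_measurable_eq) (auto simp: children_nonempty)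
    ultimately show ?thesis by simp
  qed
  ultimately show ?thesis by simp
qed

text \<open>Expectation of \<open>truncated_sum_ge\<close> with summands \<theta> times a child
  value. Products for different children factor by independence, and adding the diagonal pairs turns
  the loss into a full square.\<close>

lemma cut_value_expectation_step:
  fixes \<theta> :: real
  assumes "0 < \<theta>" "\<theta> < 1"
  defines "e \<equiv> \<lambda>l. expectation (\<lambda>\<omega>. cut_value n \<theta> l (coins \<omega>))"
  shows "\<theta> * n\<^sup>2 * p * e l - (\<theta> * n\<^sup>2 * p)\<^sup>2 / (1 - \<theta>) * (e l)\<^sup>2 \<le> e (Suc l)"
proof -
  let ?\<Phi> = "cut_value n \<theta> l"
  let ?v = "child_value ?\<Phi>" and ?S = "children n"
  note F = coin_functional_cut_value[of n \<theta> l]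
  have v01: "0 \<le> ?v c \<omega>" "?v c \<omega> \<le> 1" for c \<omega>
    using assms by (auto simp: child_value_def cut_value_nonneg cut_value_le_1)
  have int: "integrable P (?v c)" if "c \<in> ?S" for c
    using measurable_child_value[OF F that] v01 by (intro integrable_bounded)
  have Ev: "expectation (?v c) = p * e l" if "c \<in> ?S" for c
    unfolding e_def using assms that
    by (intro expectation_child_value F) (auto simp: cut_value_nonneg cut_value_le_1)
  have pair: "integrable P (\<lambda>\<omega>. ?v c \<omega> * ?v d \<omega>) \<and> expectation (\<lambda>\<omega>. ?v c \<omega> * ?v d \<omega>) = (p * e l)\<^sup>2"
    if cd: "c \<in> ?S" "d \<in> ?S" "c \<noteq> d" for c d
  proof -
    have ind: "indep_vars (\<lambda>_. borel) ?v {c, d}"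
      by (rule indep_vars_subset[OF indep_child_value[OF F]]) (use cd in auto)
    have "expectation (\<lambda>\<omega>. \<Prod>i\<in>{c, d}. ?v i \<omega>) = (\<Prod>i\<in>{c, d}. expectation (?v i))"
      by (rule indep_vars_lebesgue_integral[OF _ ind]) (use int cd in auto)
    moreover have "integrable P (\<lambda>\<omega>. \<Prod>i\<in>{c, d}. ?v i \<omega>)"
      by (rule indep_vars_integrable[OF _ ind]) (use int cd in auto)
    ultimately show ?thesis using cd Ev by (simp add: power2_eq_square)
  qed
  have cv: "cut_value n \<theta> (Suc l) (coins \<omega>) = min 1 (\<Sum>c\<in>?S. \<theta> * ?v c \<omega>)" for \<omega>
    by (simp add: child_value_def sum_distrib_left)
  let ?L = "\<lambda>\<omega>. (\<Sum>c\<in>?S. \<theta> * ?v c \<omega>) - (\<Sum>c\<in>?S. \<Sum>d\<in>?S - {c}. (\<theta> * ?v c \<omega>) * (\<theta> * ?v d \<omega>)) / (1 - \<theta>)"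
  have le: "?L \<omega> \<le> cut_value n \<theta> (Suc l) (coins \<omega>)" for \<omega>
    unfolding cv using assms v01 by (intro truncated_sum_ge) (auto intro: mult_left_le)
  have e: "(\<lambda>\<omega>. (\<theta> * ?v c \<omega>) * (\<theta> * ?v d \<omega>)) = (\<lambda>\<omega>. \<theta>\<^sup>2 * (?v c \<omega> * ?v d \<omega>))" for c d
    by (auto simp: power2_eq_square ac_simps)
  have intp: "integrable P (\<lambda>\<omega>. (\<theta> * ?v c \<omega>) * (\<theta> * ?v d \<omega>))"
    and Ep: "expectation (\<lambda>\<omega>. (\<theta> * ?v c \<omega>) * (\<theta> * ?v d \<omega>)) = \<theta>\<^sup>2 * (p * e l)\<^sup>2"
    if "c \<in> ?S" "d \<in> ?S - {c}" for c d
    unfolding e using pair[of c d] that by auto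
  have intL: "integrable P ?L"
    using int intp by (intro Bochner_Integration.integrable_diff Bochner_Integration.integrable_sum
      integrable_divide_zero integrable_mult_right impI) auto
  have "expectation ?L = (\<Sum>c\<in>?S. \<theta> * (p * e l)) - (\<Sum>c\<in>?S. \<Sum>d\<in>?S - {c}. \<theta>\<^sup>2 * (p * e l)\<^sup>2) / (1 - \<theta>)"
  proof -
    have i1: "integrable P (\<lambda>\<omega>. \<Sum>c\<in>?S. \<theta> * ?v c \<omega>)"
      using int by (intro Bochner_Integration.integrable_sum integrable_mult_right) auto
    have i2: "integrable P (\<lambda>\<omega>. \<Sum>c\<in>?S. \<Sum>d\<in>?S - {c}. (\<theta> * ?v c \<omega>) * (\<theta> * ?v d \<omega>))"
      by (intro Bochner_Integration.integrable_sum intp)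
    have "expectation (\<lambda>\<omega>. \<Sum>c\<in>?S. \<Sum>d\<in>?S - {c}. (\<theta> * ?v c \<omega>) * (\<theta> * ?v d \<omega>)) =
        (\<Sum>c\<in>?S. \<Sum>d\<in>?S - {c}. expectation (\<lambda>\<omega>. (\<theta> * ?v c \<omega>) * (\<theta> * ?v d \<omega>)))"
      by (subst Bochner_Integration.integral_sum, intro Bochner_Integration.integrable_sum intp, assumption+)
        (intro sum.cong refl Bochner_Integration.integral_sum intp)
    also have "\<dots> = (\<Sum>c\<in>?S. \<Sum>d\<in>?S - {c}. \<theta>\<^sup>2 * (p * e l)\<^sup>2)"
      by (intro sum.cong refl Ep)
    finally have 2: "expectation (\<lambda>\<omega>. \<Sum>c\<in>?S. \<Sum>d\<in>?S - {c}. (\<theta> * ?v c \<omega>) * (\<theta> * ?v d \<omega>)) = \<dots>" .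
    have "expectation (\<lambda>\<omega>. \<Sum>c\<in>?S. \<theta> * ?v c \<omega>) = (\<Sum>c\<in>?S. expectation (\<lambda>\<omega>. \<theta> * ?v c \<omega>))"
      using int by (intro Bochner_Integration.integral_sum integrable_mult_right) auto
    also have "\<dots> = (\<Sum>c\<in>?S. \<theta> * (p * e l))"
      using Ev by (intro sum.cong refl) simp
    finally show ?thesis
      using i1 i2 2 by (subst Bochner_Integration.integral_diff) (auto intro: integrable_divide_zero)
  qed
  moreover have "(\<Sum>c\<in>?S. \<Sum>d\<in>?S - {c}. \<theta>\<^sup>2 * (p * e l)\<^sup>2) / (1 - \<theta>) \<le>
      (\<theta> * n\<^sup>2 * p)\<^sup>2 * (e l)\<^sup>2 / (1 - \<theta>)"
  proof (rule divide_right_mono)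
    have "(\<Sum>c\<in>?S. \<Sum>d\<in>?S - {c}. \<theta>\<^sup>2 * (p * e l)\<^sup>2) \<le> (\<Sum>c\<in>?S. \<Sum>d\<in>?S. \<theta>\<^sup>2 * (p * e l)\<^sup>2)"
      by (intro sum_mono sum_mono2) auto
    also have "\<dots> = (\<theta> * n\<^sup>2 * p)\<^sup>2 * (e l)\<^sup>2" by (simp add: power2_eq_square)
    finally show "(\<Sum>c\<in>?S. \<Sum>d\<in>?S - {c}. \<theta>\<^sup>2 * (p * e l)\<^sup>2) \<le> (\<theta> * n\<^sup>2 * p)\<^sup>2 * (e l)\<^sup>2" .
  qed (use assms(2) in simp)
  moreover have "expectation ?L \<le> e (Suc l)"
    unfolding e_def using le assms
    by (intro integral_mono intL integrable_bounded measurable_functional coin_functional_cut_value)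
      (auto simp del: cut_value.simps simp: cut_value_nonneg cut_value_le_1)
  moreover have "(\<Sum>c\<in>?S. \<theta> * (p * e l)) = \<theta> * n\<^sup>2 * p * e l" by simp
  ultimately show ?thesis by (simp only: times_divide_eq_left)
qed

text \<open>If cut values tended to 0 almost surely, dominated convergence would send their
  expectations to 0, which the quadratic recursion forbids.\<close>

lemma prob_positive_cut:
  fixes \<theta> :: real
  assumes "0 < \<theta>" "\<theta> < 1" "1 < \<theta> * n\<^sup>2 * p"
  shows "0 < prob {\<omega> \<in> space P. positive_cut n \<theta> (coins \<omega>)}"
proof (rule ccontr)
  assume "\<not> 0 < prob {\<omega> \<in> space P. positive_cut n \<theta> (coins \<omega>)}"
  then have null: "prob {\<omega> \<in> space P. positive_cut n \<theta> (coins \<omega>)} = 0"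
    using measure_nonneg[of P] by (simp add: not_less order_antisym)
  define \<kappa> where "\<kappa> = \<theta> * n\<^sup>2 * p"
  define C where "C = \<kappa>\<^sup>2 / (1 - \<theta>)"
  define e where "e l = expectation (\<lambda>\<omega>. cut_value n \<theta> l (coins \<omega>))" for l
  have \<kappa>: "1 < \<kappa>" using assms(3) by (simp add: \<kappa>_def)
  have C: "0 < C" using \<kappa> assms(2) by (simp add: C_def)
  have p: "0 < p" using assms p_ge_0 by (cases "p = 0") auto
  have int: "integrable P (\<lambda>\<omega>. cut_value n \<theta> l (coins \<omega>))" for l
    using assms(1) by (intro integrable_bounded measurable_functional coin_functional_cut_value)
      (auto simp: cut_value_nonneg cut_value_le_1)
  have step: "\<kappa> * e l - C * (e l)\<^sup>2 \<le> e (Suc l)" for l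
    using cut_value_expectation_step[OF assms(1,2), of l] by (simp add: \<kappa>_def C_def e_def)
  have dec: "e (Suc l) \<le> e l" for l
    unfolding e_def using assms(1) by (intro integral_mono int cut_value_Suc_le) auto
  have pos: "0 < e l" for l
  proof (induction l)
    case 0
    then show ?case by (simp add: e_def prob_space)
  next
    case (Suc l)
    have vint: "integrable P (child_value (cut_value n \<theta> l) (0, 0))"
      using assms(1) by (intro integrable_bounded measurable_child_value coin_functional_cut_value zero_child)
        (auto simp: child_value_def cut_value_nonneg cut_value_le_1)
    have "\<theta> * (p * e l) = expectation (\<lambda>\<omega>. \<theta> * child_value (cut_value n \<theta> l) (0, 0) \<omega>)"
      using expectation_child_value[OF coin_functional_cut_value[of n \<theta> l] _ _ zero_child] assms(1)
      by (simp add: e_def cut_value_nonneg cut_value_le_1)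
    also have "\<dots> \<le> e (Suc l)"
      unfolding e_def
    proof (intro integral_mono int integrable_mult_right vint)
      fix \<omega>
      show "\<theta> * child_value (cut_value n \<theta> l) (0, 0) \<omega> \<le> cut_value n \<theta> (Suc l) (coins \<omega>)"
        using cut_value_Suc_ge_child[of \<theta> "(0, 0)" n "coins \<omega>" l] zero_child assms
          cut_value_nonneg[of \<theta> n "Suc l" "coins \<omega>"]
        by (auto simp: child_value_def simp del: cut_value.simps)
    qed
    finally show ?case using Suc p assms(1) by (meson less_le_trans mult_pos_pos)
  qed
  \<comment> \<open>Below this threshold the recursion would make the positive number
    \<open>e l\<close> strictly increase, contrary to monotonicity in the depth.\<close>
  have ge: "(\<kappa> - 1) / C \<le> e l" for l
  proof (rule ccontr)
    assume "\<not> ?thesis"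
    then have "C * e l < \<kappa> - 1" using C by (simp add: not_le pos_less_divide_eq mult.commute)
    then have "e l * (1 + C * e l) < e l * \<kappa>" using pos[of l] by simp
    then show False using step[of l] dec[of l] by (simp add: power2_eq_square algebra_simps)
  qed
  have "(\<lambda>l. e l) \<longlonglongrightarrow> expectation (\<lambda>_. 0)"
    unfolding e_def
  proof (rule integral_dominated_convergence[where w = "\<lambda>_. 1"])
    have "AE \<omega> in P. \<not> positive_cut n \<theta> (coins \<omega>)"
      using null prob_eq_0[OF events_functional[OF coin_functional_positive_cut[of n \<theta>]]] by auto
    then show "AE \<omega> in P. (\<lambda>l. cut_value n \<theta> l (coins \<omega>)) \<longlonglongrightarrow> 0"
    proof (rule eventually_mono)
      fix \<omega> assume np: "\<not> positive_cut n \<theta> (coins \<omega>)"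
      show "(\<lambda>l. cut_value n \<theta> l (coins \<omega>)) \<longlonglongrightarrow> 0"
      proof (rule LIMSEQ_I)
        fix r :: real assume "0 < r"
        then obtain L where "cut_value n \<theta> L (coins \<omega>) < r"
          using np positive_cutI[of r n \<theta> "coins \<omega>"] by (meson not_le)
        then show "\<exists>L. \<forall>l\<ge>L. norm (cut_value n \<theta> l (coins \<omega>) - 0) < r"
          using cut_value_antimono[of \<theta> L _ n "coins \<omega>"] cut_value_nonneg[of \<theta> n _ "coins \<omega>"] assms(1)
          by (intro exI[of _ L]) (auto intro: le_less_trans)
      qed
    qed
  qed (use assms(1) in \<open>auto simp: cut_value_nonneg cut_value_le_1 intro!: measurable_functional coin_functional_cut_value\<close>)
  then have "(\<kappa> - 1) / C \<le> 0" using ge by (intro LIMSEQ_le_const) auto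
  then show False using \<kappa> C by (simp add: divide_le_0_iff)
qed

text \<open>\<open>q\<close> is the limit of the probabilities of extinction by level
  \<open>k\<close>; splitting at the root and passing to the limit gives the fixed point
  equation.\<close>

lemma extinction_limit:
  obtains q where "0 \<le> q" "q \<le> 1" "(1 - p * (1 - q)) ^ n\<^sup>2 = q"
    and "(\<lambda>k. prob {\<omega> \<in> space P. kept_squares n (coins \<omega>) k \<noteq> {}}) \<longlonglongrightarrow> 1 - q"
proof -
  define a where "a k = prob {\<omega> \<in> space P. kept_squares n (coins \<omega>) k \<noteq> {}}" for k
  note F = coin_functional_alive[OF n_pos]
  note ev = events_functional[OF F]
  have "decseq (\<lambda>k. {\<omega> \<in> space P. kept_squares n (coins \<omega>) k \<noteq> {}})"
    by (rule decseq_SucI) auto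
  then have "decseq a" unfolding a_def
    using ev by (intro decseq_SucI finite_measure_mono) auto
  moreover have "0 \<le> a k" "a k \<le> 1" for k by (simp_all add: a_def)
  ultimately obtain L where L: "a \<longlonglongrightarrow> L" using decseq_convergent[of a 0] by blast
  have rec: "1 - a (Suc k) = (1 - p * a k) ^ n\<^sup>2" for k
  proof -
    have "(1 - p * a k) ^ n\<^sup>2 = prob {\<omega> \<in> space P. \<forall>c\<in>children n. \<not> (keep (1, c) \<omega> \<and> kept_squares n (subtree n c (coins \<omega>)) k \<noteq> {})}"
      unfolding a_def by (rule prob_no_child[OF F, symmetric])
    also have "{\<omega> \<in> space P. \<forall>c\<in>children n. \<not> (keep (1, c) \<omega> \<and> kept_squares n (subtree n c (coins \<omega>)) k \<noteq> {})}
        = space P - {\<omega> \<in> space P. kept_squares n (coins \<omega>) (Suc k) \<noteq> {}}"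
    proof -
      have "(\<forall>c\<in>children n. \<not> (keep (1, c) \<omega> \<and> kept_squares n (subtree n c (coins \<omega>)) k \<noteq> {}))
          \<longleftrightarrow> \<not> kept_squares n (coins \<omega>) (Suc k) \<noteq> {}" for \<omega>
        unfolding kept_squares_Suc_eq_empty_iff[OF n_pos, of "coins \<omega>" k] by simp
      then show ?thesis by (simp only:) auto
    qed
    also have "prob \<dots> = 1 - a (Suc k)" unfolding a_def by (rule prob_compl[OF ev])
    finally show ?thesis by simp
  qed
  have "(\<lambda>k. 1 - a (Suc k)) \<longlonglongrightarrow> 1 - L" by (intro tendsto_intros LIMSEQ_Suc L)
  moreover have "(\<lambda>k. (1 - p * a k) ^ n\<^sup>2) \<longlonglongrightarrow> (1 - p * L) ^ n\<^sup>2" by (intro tendsto_intros L)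
  ultimately have "1 - L = (1 - p * L) ^ n\<^sup>2" unfolding rec by (rule LIMSEQ_unique)
  moreover have "1 - (1 - L) = L" by simp
  ultimately have fixed: "(1 - p * (1 - (1 - L))) ^ n\<^sup>2 = 1 - L" by metis
  have "0 \<le> L" "L \<le> 1"
    using L \<open>\<And>k. 0 \<le> a k\<close> \<open>\<And>k. a k \<le> 1\<close> by (auto intro: LIMSEQ_le_const LIMSEQ_le_const2)
  then have "0 \<le> 1 - L" "1 - L \<le> 1" by simp_all
  moreover note fixed
  moreover have "(\<lambda>k. prob {\<omega> \<in> space P. kept_squares n (coins \<omega>) k \<noteq> {}}) \<longlonglongrightarrow> 1 - (1 - L)"
    using L unfolding a_def by simp
  ultimately show ?thesis by (rule that)
qed

lemma AE_extinct:
  assumes "0 < p" "real (n\<^sup>2) * p \<le> 1"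
  shows "AE \<omega> in P. \<exists>k. kept_squares n (coins \<omega>) k = {}"
proof -
  obtain q where q: "0 \<le> q" "q \<le> 1" "(1 - p * (1 - q)) ^ n\<^sup>2 = q"
      "(\<lambda>k. prob {\<omega> \<in> space P. kept_squares n (coins \<omega>) k \<noteq> {}}) \<longlonglongrightarrow> 1 - q"
    by (rule extinction_limit)
  have "2 \<le> n\<^sup>2" using n_ge_2 power_mono[of 2 n 2] by simp
  then have "q = 1"
    using power_fixed_point_subcritical[OF assms(1) p_le_1 _ q(1) _ assms(2) q(3)] q(2) by force
  note ev = events_functional[OF coin_functional_alive[OF n_pos]]
  let ?N = "\<Inter>k. {\<omega> \<in> space P. kept_squares n (coins \<omega>) k \<noteq> {}}"
  have N: "?N \<in> events" using ev by blast
  have "prob ?N \<le> 1 - q"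
    using ev by (intro LIMSEQ_le_const[OF q(4)]) (auto intro!: finite_measure_mono)
  then have "prob ?N = 0" using \<open>q = 1\<close> measure_nonneg[of P ?N] by simp
  then have "AE \<omega> in P. \<omega> \<notin> ?N" using prob_eq_0[OF N] by simp
  then show ?thesis by (rule AE_mp) (auto intro!: AE_I2)
qed

text \<open>Positivity implies survival to every depth, so the exceptional event has probability at
  most \<open>r - q\<close>, where \<open>r\<close> is the probability of failure of
  positivity.\<close>

lemma AE_positive_cut:
  fixes \<theta> :: real
  assumes "0 < \<theta>" "\<theta> < 1" "1 < \<theta> * n\<^sup>2 * p"
  shows "AE \<omega> in P. positive_cut n \<theta> (coins \<omega>) \<or> (\<exists>k. kept_squares n (coins \<omega>) k = {})"
proof -
  have p: "0 < p" using assms p_ge_0 by (cases "p = 0") auto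
  obtain q where q: "0 \<le> q" "q \<le> 1" "(1 - p * (1 - q)) ^ n\<^sup>2 = q"
      "(\<lambda>k. prob {\<omega> \<in> space P. kept_squares n (coins \<omega>) k \<noteq> {}}) \<longlonglongrightarrow> 1 - q"
    by (rule extinction_limit)
  have N: "2 \<le> n\<^sup>2" using n_ge_2 power_mono[of 2 n 2] by simp
  let ?Pos = "{\<omega> \<in> space P. positive_cut n \<theta> (coins \<omega>)}"
  let ?A = "\<lambda>k. {\<omega> \<in> space P. kept_squares n (coins \<omega>) k \<noteq> {}}"
  note F = coin_functional_positive_cut[of n \<theta>]
  note evP = events_functional[OF F]
  note evA = events_functional[OF coin_functional_alive[OF n_pos]]
  define r where "r = 1 - prob ?Pos"
  have "r < 1" using prob_positive_cut[OF assms] by (simp add: r_def)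
  have "r = prob (space P - ?Pos)" unfolding r_def by (rule prob_compl[OF evP, symmetric])
  \<comment> \<open>If positivity fails at the root, it fails in every kept child; hence
    \<open>r\<close> is a subsolution.\<close>
  also have "\<dots> \<le> prob {\<omega> \<in> space P. \<forall>c\<in>children n. \<not> (keep (1, c) \<omega> \<and> positive_cut n \<theta> (subtree n c (coins \<omega>)))}"
  proof (rule finite_measure_mono)
    show "space P - ?Pos \<subseteq> {\<omega> \<in> space P. \<forall>c\<in>children n. \<not> (keep (1, c) \<omega> \<and> positive_cut n \<theta> (subtree n c (coins \<omega>)))}"
    proof -
      have "positive_cut n \<theta> (coins \<omega>)"
        if "c \<in> children n" "keep (1, c) \<omega>" "positive_cut n \<theta> (subtree n c (coins \<omega>))" for c \<omega>
        by (rule positive_cut_subtree[where c = c]) (use assms that in auto)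
      then show ?thesis by auto
    qed
    have "{\<omega> \<in> space P. keep (1, c) \<omega> \<and> positive_cut n \<theta> (subtree n c (coins \<omega>))} \<in> events"
      if "c \<in> children n" for c
    proof -
      have "coin_functional n (\<lambda>kp. of_bool (kp (1, c) \<and> positive_cut n \<theta> (subtree n c kp)))"
      proof -
        have "(\<lambda>kp. of_bool (kp (1, c) \<and> positive_cut n \<theta> (subtree n c kp)) :: real) =
            (\<lambda>kp. if kp (1, c) then of_bool (positive_cut n \<theta> (subtree n c kp)) else 0)" by auto
        then show ?thesis using coin_functional_child[OF F that] by simp
      qed
      from events_functional[OF this] show ?thesis .
    qed
    then show "{\<omega> \<in> space P. \<forall>c\<in>children n. \<not> (keep (1, c) \<omega> \<and> positive_cut n \<theta> (subtree n c (coins \<omega>)))} \<in> events"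
      by (intro sets.sets_Collect_finite_All' sets.sets_Collect_neg) (auto simp: children_nonempty)
  qed
  also have "\<dots> = (1 - p * (1 - r)) ^ n\<^sup>2"
    unfolding r_def by (subst prob_no_child[OF F]) simp
  finally have "r \<le> q"
    using power_fixed_point_unique[OF p p_le_1 N q(1) _ \<open>r < 1\<close> q(3)] by force
  let ?N = "(space P - ?Pos) \<inter> (\<Inter>k. ?A k)"
  have evN: "?N \<in> events" using evP evA by blast
  have "prob ?N \<le> 1 - q - (1 - r)"
  proof (rule LIMSEQ_le_const)
    show "(\<lambda>k. prob (?A k) - (1 - r)) \<longlonglongrightarrow> 1 - q - (1 - r)" by (intro tendsto_intros q)
    have "prob ?N \<le> prob (?A k) - (1 - r)" for k
    proof -
      have "\<not> positive_cut n \<theta> (coins \<omega>)" if "kept_squares n (coins \<omega>) k = {}" for \<omega>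
        using that not_positive_cut n_pos assms(1) by simp
      then have sub: "?Pos \<subseteq> ?A k" by auto
      have "prob ?N \<le> prob (?A k - ?Pos)" using evA evP by (intro finite_measure_mono) auto
      also have "\<dots> = prob (?A k) - prob ?Pos" by (rule finite_measure_Diff[OF evA evP sub])
      finally show ?thesis by (simp add: r_def)
    qed
    then show "\<exists>N. \<forall>k\<ge>N. prob ?N \<le> prob (?A k) - (1 - r)" by blast
  qed
  then have "prob ?N = 0" using \<open>r \<le> q\<close> measure_nonneg[of P ?N] by linarith
  then have "AE \<omega> in P. \<omega> \<notin> ?N" using prob_eq_0[OF evN] by simp
  then show ?thesis by (rule AE_mp) (auto intro!: AE_I2)
qed

end

section \<open>Pairs of kept neighbouring squares\<close>

definition neighbour_pairs :: "nat \<Rightarrow> nat \<Rightarrow> nat \<Rightarrow> ((nat \<times> nat) \<times> (nat \<times> nat)) set" where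
  "neighbour_pairs n k m =
     {(a, b). a \<in> {..<n ^ (k + m)} \<times> {..<n ^ (k + m)} \<and> b \<in> {..<n ^ (k + m)} \<times> {..<n ^ (k + m)} \<and>
        ancestor n m a \<noteq> ancestor n m b \<and> grid_square n (k + m) a \<inter> grid_square n (k + m) b \<noteq> {}}"

text \<open>Touching squares differ by at most 1 in each coordinate, and different
  level-\<open>k\<close> ancestors force a level-\<open>k\<close> grid line between them in at least
  one coordinate.\<close>

lemma card_neighbour_pairs:
  assumes "0 < n"
  shows "finite (neighbour_pairs n k m)" "card (neighbour_pairs n k m) \<le> 12 * n ^ k * n ^ (k + m)"
proof -
  let ?N = "n ^ (k + m)"
  \<comment> \<open>\<open>S\<close> holds the coordinate pairs straddling a level-\<open>k\<close>
    grid line, at most \<open>2 * n ^ k\<close>; \<open>T\<close> holds those differing by at most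
    1, at most \<open>3 * n ^ (k + m)\<close>. Choosing the straddling coordinate doubles the
    product to 12. At 0, truncated subtraction only adds a pair \<open>(0, 0)\<close>.\<close>
  define S where "S = (\<lambda>q. (q * n ^ m + n ^ m - 1, q * n ^ m + n ^ m)) ` {..<n ^ k} \<union>
      (\<lambda>q. (q * n ^ m, q * n ^ m - 1)) ` {..<n ^ k}"
  define T where "T = (\<lambda>i. (i, i)) ` {..<?N} \<union> (\<lambda>i. (i, i + 1)) ` {..<?N} \<union> (\<lambda>i. (i, i - 1)) ` {..<?N}"
  let ?f = "\<lambda>((i, i'), (j, j')). ((i, j), (i', j'))"
  have finST: "finite S" "finite T" by (auto simp: S_def T_def)
  have "card S \<le> n ^ k + n ^ k"
    unfolding S_def by (rule order_trans[OF card_Un_le] add_mono)+ (auto intro!: card_image_le[THEN order_trans])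
  moreover have "card T \<le> ?N + ?N + ?N"
    unfolding T_def by (rule order_trans[OF card_Un_le] add_mono)+ (auto intro!: card_image_le[THEN order_trans])
  ultimately have ST: "card S * card T \<le> (2 * n ^ k) * (3 * ?N)" by (intro mult_mono) auto
  have near: "i \<le> i' + 1" if "real i \<le> x" "x \<le> real i' + 1" for i i' x
    using that by linarith
  have inT: "(i, i') \<in> T" if "i < ?N" "i \<le> i' + 1" "i' \<le> i + 1" for i i'
  proof -
    have "i' = i \<or> i' = i + 1 \<or> i' = i - 1" using that by linarith
    then show ?thesis using that by (auto simp: T_def)
  qed
  have inS: "(i, i') \<in> S" if "i < ?N" "i \<le> i' + 1" "i' \<le> i + 1" "i div n ^ m \<noteq> i' div n ^ m" for i i'
  proof -
    let ?q = "i div n ^ m"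
    have q: "?q < n ^ k" using that(1) assms by (simp add: div_less_iff_less_mult power_add)
    have i: "?q * n ^ m \<le> i" "i < ?q * n ^ m + n ^ m"
      using assms dividend_less_div_times[of "n ^ m" i] by (simp_all add: div_times_less_eq_dividend add.commute)
    have out: "i' < ?q * n ^ m \<or> ?q * n ^ m + n ^ m \<le> i'"
    proof (rule ccontr)
      assume "\<not> ?thesis"
      then have "i' div n ^ m = ?q" by (intro div_nat_eqI) (auto simp: ac_simps)
      then show False using that(4) by simp
    qed
    then have "i = ?q * n ^ m + n ^ m - 1 \<and> i' = ?q * n ^ m + n ^ m \<or> i = ?q * n ^ m \<and> i' = ?q * n ^ m - 1"
      using that i by linarith
    then show ?thesis
    proof (elim disjE)
      assume 1: "i = ?q * n ^ m + n ^ m - 1 \<and> i' = ?q * n ^ m + n ^ m"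
      then have "(i, i') = (?q * n ^ m + n ^ m - 1, ?q * n ^ m + n ^ m)" by simp
      then show ?thesis unfolding S_def using q by blast
    next
      assume 2: "i = ?q * n ^ m \<and> i' = ?q * n ^ m - 1"
      then have "(i, i') = (?q * n ^ m, ?q * n ^ m - 1)" by simp
      then show ?thesis unfolding S_def using q by blast
    qed
  qed
  have sub: "neighbour_pairs n k m \<subseteq> ?f ` (S \<times> T) \<union> ?f ` (T \<times> S)"
  proof
    fix u assume u: "u \<in> neighbour_pairs n k m"
    obtain i j i' j' where ij: "u = ((i, j), (i', j'))" by (metis prod.exhaust)
    have lt: "i < ?N" "j < ?N" using u by (auto simp: ij neighbour_pairs_def)
    obtain z where z: "z \<in> grid_square n (k + m) (i, j)" "z \<in> grid_square n (k + m) (i', j')"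
      using u by (auto simp: ij neighbour_pairs_def)
    then have nb: "i \<le> i' + 1" "i' \<le> i + 1" "j \<le> j' + 1" "j' \<le> j + 1"
      unfolding mem_grid_square[OF assms] by (auto intro: near)
    have "i div n ^ m \<noteq> i' div n ^ m \<or> j div n ^ m \<noteq> j' div n ^ m"
      using u by (auto simp: ij neighbour_pairs_def ancestor_def)
    then have "((i, i'), (j, j')) \<in> S \<times> T \<union> T \<times> S"
      using inS[OF lt(1) nb(1,2)] inS[OF lt(2) nb(3,4)] inT[OF lt(1) nb(1,2)] inT[OF lt(2) nb(3,4)] by blast
    then show "u \<in> ?f ` (S \<times> T) \<union> ?f ` (T \<times> S)" by (force simp: ij)
  qed
  then show "finite (neighbour_pairs n k m)" using finST by (auto intro: finite_subset)
  have "card (neighbour_pairs n k m) \<le> card (?f ` (S \<times> T) \<union> ?f ` (T \<times> S))"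
    using finST by (intro card_mono sub) auto
  also have "\<dots> \<le> card (?f ` (S \<times> T)) + card (?f ` (T \<times> S))" by (rule card_Un_le)
  also have "\<dots> \<le> card S * card T + card T * card S"
    using finST by (intro add_mono order_trans[OF card_image_le]) (auto simp: card_cartesian_product)
  also have "\<dots> = 2 * (card S * card T)" by simp
  also have "\<dots> \<le> 2 * ((2 * n ^ k) * (3 * ?N))" by (intro mult_left_mono ST) simp
  also have "\<dots> = 12 * n ^ k * ?N" by simp
  finally show "card (neighbour_pairs n k m) \<le> 12 * n ^ k * n ^ (k + m)" .
qed

definition kept_pairs ::
    "nat \<Rightarrow> (nat \<times> nat \<times> nat \<Rightarrow> bool) \<Rightarrow> nat \<Rightarrow> nat \<Rightarrow> ((nat \<times> nat) \<times> (nat \<times> nat)) set" where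
  "kept_pairs n kp k m =
     {(a, b) \<in> neighbour_pairs n k m. a \<in> kept_squares n kp (k + m) \<and> b \<in> kept_squares n kp (k + m)}"

lemma double_points_subset:
  assumes "0 < n"
  shows "double_points n kp k \<subseteq> (\<Union>c\<in>fst ` kept_pairs n kp k m. grid_square n (k + m) c)"
proof
  fix z assume "z \<in> double_points n kp k"
  then obtain a b where ab: "a \<in> kept_squares n kp (k + m)" "b \<in> kept_squares n kp (k + m)"
      "ancestor n m a \<noteq> ancestor n m b" "z \<in> grid_square n (k + m) a" "z \<in> grid_square n (k + m) b"
    unfolding double_points_def by blast
  then have "(a, b) \<in> kept_pairs n kp k m"
    using kept_squares_subset[OF assms] unfolding kept_pairs_def neighbour_pairs_def by blast
  then show "z \<in> (\<Union>c\<in>fst ` kept_pairs n kp k m. grid_square n (k + m) c)" using ab(4) by force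
qed

context percolation begin

text \<open>Different level-\<open>k\<close> ancestors keep the two lineages disjoint on the next
  \<open>m\<close> levels, so \<open>2 * m\<close> independent decisions must succeed. Decisions up
  to level \<open>k\<close>, possibly shared, are bounded by 1.\<close>

lemma prob_both_kept:
  assumes "ancestor n m a \<noteq> ancestor n m b"
    and "a \<in> {..<n ^ (k + m)} \<times> {..<n ^ (k + m)}" "b \<in> {..<n ^ (k + m)} \<times> {..<n ^ (k + m)}"
  shows "prob {\<omega> \<in> space P. a \<in> kept_squares n (coins \<omega>) (k + m) \<and> b \<in> kept_squares n (coins \<omega>) (k + m)}
    \<le> (p\<^sup>2) ^ m"
proof -
  \<comment> \<open>The lineage of \<open>c\<close> at level \<open>k + l + 1\<close>, which lies
    \<open>m - Suc l\<close> levels above level \<open>k + m\<close>.\<close>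
  define f where "f c l = (Suc (k + l), ancestor n (m - Suc l) c)" for c l
  define J where "J = f a ` {..<m} \<union> f b ` {..<m}"
  have idx: "f c l \<in> percolation_index n"
    if "c \<in> {..<n ^ (k + m)} \<times> {..<n ^ (k + m)}" "l < m" for c l
  proof -
    have "n ^ (k + m) = n ^ Suc (k + l) * n ^ (m - Suc l)"
      using that(2) by (simp flip: power_add power_Suc)
    then have "i div n ^ (m - Suc l) < n ^ Suc (k + l)" if "i < n ^ (k + m)" for i
      using that n_pos by (simp add: div_less_iff_less_mult)
    then show ?thesis using that(1) by (auto simp: f_def percolation_index_def ancestor_def)
  qed
  have J: "J \<subseteq> percolation_index n" "finite J" using idx assms(2,3) by (auto simp: J_def)
  have disj: "f a ` {..<m} \<inter> f b ` {..<m} = {}"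
  proof (rule ccontr)
    assume "\<not> ?thesis"
    then obtain l l' where "f a l = f b l'" by blast
    then have "ancestor n (m - Suc l) a = ancestor n (m - Suc l) b" by (auto simp: f_def)
    then have "ancestor n m a = ancestor n m b" by (rule ancestor_mono) simp
    then show False using assms(1) by simp
  qed
  have inj: "inj_on (f c) {..<m}" for c by (auto simp: inj_on_def f_def)
  have card: "card J = 2 * m" unfolding J_def
    by (subst card_Un_disjoint[OF _ _ disj]) (auto simp: card_image[OF inj])
  have kept: "keep (f c l) \<omega>" if "c \<in> kept_squares n (coins \<omega>) (k + m)" "l < m" for c l \<omega>
  proof -
    have "c \<in> kept_squares n (coins \<omega>) (Suc (k + l) + (m - Suc l))" using that by simp
    from kept_squares_keep[OF this] show ?thesis by (simp add: f_def)
  qed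
  have ev: "keep c -` {True} \<inter> space P \<in> events" if "c \<in> percolation_index n" for c
    using measurable_keep[OF that] by (rule measurable_sets) simp
  have pr: "prob (keep c -` {True} \<inter> space P) = p" if "c \<in> percolation_index n" for c
    using prob_keep[OF that] by (simp add: vimage_def Int_def conj_commute)
  show ?thesis
  proof (cases "m = 0")
    case False
    then have "J \<noteq> {}" by (auto simp: J_def)
    have "prob {\<omega> \<in> space P. a \<in> kept_squares n (coins \<omega>) (k + m) \<and> b \<in> kept_squares n (coins \<omega>) (k + m)}
        \<le> prob (\<Inter>c\<in>J. keep c -` {True} \<inter> space P)"
    proof (rule finite_measure_mono)
      show "(\<Inter>c\<in>J. keep c -` {True} \<inter> space P) \<in> events"
        using J ev \<open>J \<noteq> {}\<close> by (intro sets.finite_INT) auto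
      have "keep c \<omega>" if "a \<in> kept_squares n (coins \<omega>) (k + m)" "b \<in> kept_squares n (coins \<omega>) (k + m)" "c \<in> J" for c \<omega>
        using that(3) kept[OF that(1)] kept[OF that(2)] unfolding J_def by blast
      then show "{\<omega> \<in> space P. a \<in> kept_squares n (coins \<omega>) (k + m) \<and> b \<in> kept_squares n (coins \<omega>) (k + m)}
          \<subseteq> (\<Inter>c\<in>J. keep c -` {True} \<inter> space P)" by auto
    qed
    also have "\<dots> = (\<Prod>c\<in>J. prob (keep c -` {True} \<inter> space P))"
      using J \<open>J \<noteq> {}\<close> by (intro indep_varsD[OF indep_keep]) auto
    also have "\<dots> = (\<Prod>c\<in>J. p)" using J pr by (intro prod.cong) auto
    also have "\<dots> = (p\<^sup>2) ^ m" by (simp add: card power_mult)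
    finally show ?thesis .
  qed simp
qed

lemma events_kept:
  assumes "c \<in> {..<n ^ k} \<times> {..<n ^ k}"
  shows "{\<omega> \<in> space P. c \<in> kept_squares n (coins \<omega>) k} \<in> events"
  using assms
proof (induction k arbitrary: c)
  case (Suc k)
  obtain i j where c: "c = (i, j)" by (cases c)
  have "(i div n, j div n) \<in> {..<n ^ k} \<times> {..<n ^ k}" "(Suc k, i, j) \<in> percolation_index n"
    using Suc.prems n_pos by (auto simp: c div_less_iff_less_mult percolation_index_def mult.commute)
  then have [measurable]: "{\<omega> \<in> space P. (i div n, j div n) \<in> kept_squares n (coins \<omega>) k} \<in> events"
      "keep (Suc k, i, j) \<in> P \<rightarrow>\<^sub>M count_space UNIV"
    by (auto intro: Suc.IH measurable_keep)
  have "{\<omega> \<in> space P. c \<in> kept_squares n (coins \<omega>) (Suc k)} =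
      {\<omega> \<in> space P. (i div n, j div n) \<in> kept_squares n (coins \<omega>) k} \<inter> {\<omega> \<in> space P. keep (Suc k, i, j) \<omega>}"
    by (auto simp: c)
  also have "\<dots> \<in> events" by measurable
  finally show ?case .
qed simp

text \<open>First moment: the expectations decay geometrically with ratio
  \<open>n * p^2 * \<beta>\<close>, so the series is finite almost surely. The weight
  \<open>\<beta>\<close> is \<open>n powr - s\<close> for dimension bounds and 1 for
  emptiness.\<close>

lemma AE_kept_pairs:
  assumes "0 < \<beta>" "real n * p\<^sup>2 * \<beta> < 1"
  shows "AE \<omega> in P. (\<lambda>m. real (card (kept_pairs n (coins \<omega>) k m)) * \<beta> ^ m) \<longlonglongrightarrow> 0"
proof -
  let ?D = "neighbour_pairs n k"
  let ?E = "\<lambda>m u. {\<omega> \<in> space P. fst u \<in> kept_squares n (coins \<omega>) (k + m) \<and> snd u \<in> kept_squares n (coins \<omega>) (k + m)}"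
  have ev: "?E m u \<in> events" if "u \<in> ?D m" for m u
  proof -
    have "?E m u = {\<omega> \<in> space P. fst u \<in> kept_squares n (coins \<omega>) (k + m)} \<inter>
        {\<omega> \<in> space P. snd u \<in> kept_squares n (coins \<omega>) (k + m)}" by auto
    also have "\<dots> \<in> events" using that by (intro sets.Int events_kept) (auto simp: neighbour_pairs_def)
    finally show ?thesis .
  qed
  define X where "X m \<omega> = (\<Sum>u\<in>?D m. indicator (?E m u) \<omega>) * \<beta> ^ m" for m \<omega>
  have X: "X m \<omega> = real (card (kept_pairs n (coins \<omega>) k m)) * \<beta> ^ m" if "\<omega> \<in> space P" for m \<omega>
  proof -
    have "(\<Sum>u\<in>?D m. indicator (?E m u) \<omega>) = (\<Sum>u\<in>?D m. if u \<in> kept_pairs n (coins \<omega>) k m then 1 else 0 :: real)"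
      using that by (intro sum.cong) (auto simp: kept_pairs_def indicator_def)
    also have "\<dots> = real (card (?D m \<inter> kept_pairs n (coins \<omega>) k m))"
      using card_neighbour_pairs(1)[OF n_pos] by (simp add: sum.If_cases)
    also have "?D m \<inter> kept_pairs n (coins \<omega>) k m = kept_pairs n (coins \<omega>) k m"
      by (auto simp: kept_pairs_def)
    finally show ?thesis by (simp add: X_def)
  qed
  have X0: "0 \<le> X m \<omega>" for m \<omega>
    using assms by (auto simp: X_def intro!: mult_nonneg_nonneg sum_nonneg)
  have [measurable]: "X m \<in> borel_measurable P" for m
    unfolding X_def using ev by (intro borel_measurable_times borel_measurable_sum borel_measurable_indicator) auto
  define r where "r = real n * p\<^sup>2 * \<beta>"
  have r: "0 \<le> r" "r < 1" using assms by (auto simp: r_def)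
  have int: "integrable P (X m)" for m
    unfolding X_def using ev
    by (intro integrable_mult_left Bochner_Integration.integrable_sum integrable_real_indicator) (auto simp: emeasure_eq_measure)
  have EX: "expectation (X m) \<le> 12 * real n ^ (2 * k) * r ^ m" for m
  proof -
    have "expectation (X m) = (\<Sum>u\<in>?D m. prob (?E m u)) * \<beta> ^ m"
      unfolding X_def using ev
      by (subst integral_mult_left_zero, subst Bochner_Integration.integral_sum)
        (auto intro!: integrable_real_indicator simp: emeasure_eq_measure)
    also have "\<dots> \<le> (\<Sum>u\<in>?D m. (p\<^sup>2) ^ m) * \<beta> ^ m"
      using assms(1) by (intro mult_right_mono sum_mono prob_both_kept) (auto simp: neighbour_pairs_def)
    also have "\<dots> = real (card (?D m)) * ((p\<^sup>2) ^ m * \<beta> ^ m)" by simp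
    also have "\<dots> \<le> real (12 * n ^ k * n ^ (k + m)) * ((p\<^sup>2) ^ m * \<beta> ^ m)"
      using assms(1) card_neighbour_pairs(2)[OF n_pos] by (intro mult_right_mono of_nat_mono) auto
    also have "\<dots> = 12 * real n ^ (2 * k) * r ^ m"
      by (simp add: r_def power_add power_mult_distrib mult_2)
    finally show ?thesis .
  qed
  have "(\<integral>\<^sup>+\<omega>. (\<Sum>m. ennreal (X m \<omega>)) \<partial>P) = (\<Sum>m. \<integral>\<^sup>+\<omega>. ennreal (X m \<omega>) \<partial>P)"
    by (intro nn_integral_suminf) measurable
  also have "\<dots> = (\<Sum>m. ennreal (expectation (X m)))"
    using int X0 by (intro suminf_cong nn_integral_eq_integral) auto
  also have "\<dots> \<le> (\<Sum>m. ennreal (12 * real n ^ (2 * k) * r ^ m))"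
    by (intro suminf_le ennreal_leI EX) auto
  also have "\<dots> = ennreal (\<Sum>m. 12 * real n ^ (2 * k) * r ^ m)"
    using r by (intro suminf_ennreal2 summable_mult summable_geometric) auto
  also have "\<dots> < \<top>" by simp
  finally have "AE \<omega> in P. (\<Sum>m. ennreal (X m \<omega>)) \<noteq> \<infinity>"
    by (intro nn_integral_noteq_infinite) auto
  then show ?thesis
  proof (rule AE_mp, intro AE_I2 impI)
    fix \<omega> assume \<omega>: "\<omega> \<in> space P" and "(\<Sum>m. ennreal (X m \<omega>)) \<noteq> \<infinity>"
    then have "summable (\<lambda>m. X m \<omega>)" using X0 by (intro summable_suminf_not_top) auto
    then have "(\<lambda>m. X m \<omega>) \<longlonglongrightarrow> 0" by (rule summable_LIMSEQ_zero)
    then show "(\<lambda>m. real (card (kept_pairs n (coins \<omega>) k m)) * \<beta> ^ m) \<longlonglongrightarrow> 0"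
      using X[OF \<omega>] by simp
  qed
qed

lemma AE_hausdorff_dim_double_points:
  assumes "0 \<le> s" "real n * p\<^sup>2 < real n powr s"
  shows "AE \<omega> in P. \<forall>k. hausdorff_dim (double_points n (coins \<omega>) k) \<le> ereal s"
proof -
  let ?\<beta> = "real n powr - s"
  have \<beta>: "0 < ?\<beta>" "real n * p\<^sup>2 * ?\<beta> < 1"
    using n_pos assms(2) by (simp_all add: powr_minus_divide)
  have *: "hausdorff_dim (double_points n (coins \<omega>) k) \<le> ereal s"
    if lim: "(\<lambda>m. real (card (kept_pairs n (coins \<omega>) k m)) * ?\<beta> ^ m) \<longlonglongrightarrow> 0" for \<omega> k
  proof (rule hausdorff_dim_le[OF assms(1)])
    let ?A = "\<lambda>m. fst ` kept_pairs n (coins \<omega>) k m"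
    have fin: "finite (kept_pairs n (coins \<omega>) k m)" for m
      by (rule finite_subset[OF _ card_neighbour_pairs(1)[OF n_pos]]) (auto simp: kept_pairs_def)
    have pw: "(1 / real n ^ (k + m)) powr s = ?\<beta> ^ k * ?\<beta> ^ m" for m
    proof -
      have "(1 / real n ^ (k + m)) powr s = ?\<beta> ^ (k + m)"
        using n_pos by (simp add: powr_power powr_minus_divide powr_divide powr_realpow[symmetric] powr_powr
            mult.commute)
      then show ?thesis by (simp add: power_add)
    qed
    have "(\<lambda>m. ?\<beta> ^ k * (real (card (kept_pairs n (coins \<omega>) k m)) * ?\<beta> ^ m)) \<longlonglongrightarrow> ?\<beta> ^ k * 0"
      by (intro tendsto_intros lim)
    then have lim0: "(\<lambda>m. ?\<beta> ^ k * (real (card (kept_pairs n (coins \<omega>) k m)) * ?\<beta> ^ m)) \<longlonglongrightarrow> 0"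
      by simp
    have le: "real (card (?A m)) * (1 / real n ^ (k + m)) powr s
        \<le> ?\<beta> ^ k * (real (card (kept_pairs n (coins \<omega>) k m)) * ?\<beta> ^ m)" for m
      unfolding pw mult.left_commute[of "?\<beta> ^ k"]
      by (intro mult_right_mono of_nat_mono card_image_le fin) simp
    have "(\<lambda>m. real (card (?A m)) * (1 / real n ^ (k + m)) powr s) \<longlonglongrightarrow> 0"
    proof (rule Lim_null_comparison[OF _ lim0], intro always_eventually allI)
      fix m
      show "norm (real (card (?A m)) * (1 / real n ^ (k + m)) powr s)
          \<le> ?\<beta> ^ k * (real (card (kept_pairs n (coins \<omega>) k m)) * ?\<beta> ^ m)"
        unfolding real_norm_def by (subst abs_of_nonneg) (simp, rule le)
    qed
    then show "hausdorff_measure s (double_points n (coins \<omega>) k) = 0"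
      using n_ge_2 assms(1) fin double_points_subset[OF n_pos]
      by (intro hausdorff_measure_grid_cover[where A = ?A and l = k]) auto
  qed
  then show ?thesis
    unfolding AE_all_countable using AE_kept_pairs[OF \<beta>]
    by (intro allI eventually_mono[OF _ *])
qed

text \<open>With \<open>\<beta> = 1\<close> the numbers of pairs are integers tending to 0, so some
  level has no pair left.\<close>

lemma AE_double_points_empty:
  assumes "real n * p\<^sup>2 < 1"
  shows "AE \<omega> in P. \<forall>k. double_points n (coins \<omega>) k = {}"
proof -
  have *: "double_points n (coins \<omega>) k = {}"
    if lim: "(\<lambda>m. real (card (kept_pairs n (coins \<omega>) k m)) * 1 ^ m) \<longlonglongrightarrow> 0" for \<omega> k
  proof -
    have "\<forall>\<^sub>F m in sequentially. real (card (kept_pairs n (coins \<omega>) k m)) * 1 ^ m < 1"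
      using lim by (rule order_tendstoD(2)) simp
    then obtain m where "card (kept_pairs n (coins \<omega>) k m) = 0"
      using eventually_happens by fastforce
    moreover have "finite (kept_pairs n (coins \<omega>) k m)"
      by (rule finite_subset[OF _ card_neighbour_pairs(1)[OF n_pos]]) (auto simp: kept_pairs_def)
    ultimately have "kept_pairs n (coins \<omega>) k m = {}" by simp
    then show ?thesis using double_points_subset[OF n_pos, of "coins \<omega>" k m] by simp
  qed
  then show ?thesis
    unfolding AE_all_countable using AE_kept_pairs[of 1] assms
    by (intro allI eventually_mono[OF _ *]) auto
qed

end

section \<open>Choice of the exponents\<close>

lemma obtain_powr_between:
  fixes a b :: real
  assumes "2 \<le> n" "0 < a" "a < b"
  obtains t where "a < real n powr t" "real n powr t < b"
proof -
  obtain u where "a < u" "u < b" using dense[OF assms(3)] by blast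
  then show ?thesis using assms by (intro that[of "log (real n) u"]) auto
qed

lemma (in percolation) AE_dims:
  assumes p: "0 < p" "p < 1" and "1 < real (n\<^sup>2) * p"
  obtains t d where "0 < t" "1 < real n powr - t * n\<^sup>2 * p" "d < ereal t"
    and "AE \<omega> in P. \<forall>k. hausdorff_dim (double_points n (coins \<omega>) k) \<le> d - 1"
proof (cases "real n * p \<le> 1")
  case True
  obtain t where t: "1 < real n powr t" "real n powr t < real (n\<^sup>2) * p"
    using obtain_powr_between[OF n_ge_2 _ assms(3)] by auto
  show ?thesis
  proof (rule that[of t 0])
    show "0 < t" using t(1) n_ge_2 powr_less_cancel_iff[of "real n" 0 t] by simp
    then show "0 < ereal t" by simp
    show "1 < real n powr - t * n\<^sup>2 * p" using t(2) n_pos by (simp add: powr_minus_divide pos_less_divide_eq)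
    \<comment> \<open>Here an \<open>s\<close> with \<open>n powr s < n * p\<close> would be
      negative; instead \<open>n * p^2 < 1\<close> makes all boundaries empty, and their dimension
      -1 is \<open>d - 1\<close> for \<open>d = 0\<close>.\<close>
    have "real n * p * p \<le> 1 * p" using True p by (intro mult_right_mono) auto
    then have "real n * p\<^sup>2 \<le> p" by (simp add: power2_eq_square mult.assoc)
    then have "real n * p\<^sup>2 < 1" using p(2) by linarith
    from AE_double_points_empty[OF this]
    show "AE \<omega> in P. \<forall>k. hausdorff_dim (double_points n (coins \<omega>) k) \<le> 0 - 1"
      by eventually_elim (simp add: hausdorff_dim_def)
  qed
next
  case False
  \<comment> \<open>The maximum with 1 keeps \<open>s\<close> nonnegative; \<open>p < 1\<close> is
    what separates \<open>n * p^2\<close> from \<open>n * p\<close>.\<close>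
  have "max 1 (real n * p\<^sup>2) < real n * p"
    using False p n_pos by (auto simp: power2_eq_square)
  moreover have "0 < max 1 (real n * p\<^sup>2)" by (simp add: less_max_iff_disj)
  ultimately obtain s where s: "max 1 (real n * p\<^sup>2) < real n powr s" "real n powr s < real n * p"
    using obtain_powr_between[OF n_ge_2] by blast
  have "real n powr (s + 1) < real (n\<^sup>2) * p"
    using s(2) n_pos by (simp add: powr_add power2_eq_square mult.commute)
  then obtain t where t: "real n powr (s + 1) < real n powr t" "real n powr t < real (n\<^sup>2) * p"
    using obtain_powr_between[OF n_ge_2, of "real n powr (s + 1)" "real (n\<^sup>2) * p"] n_pos by auto
  have s0: "0 \<le> s"
  proof (rule ccontr)
    assume "\<not> 0 \<le> s"
    then have "real n powr s \<le> real n powr 0" using n_pos by (intro powr_mono) auto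
    then show False using s(1) n_pos by simp
  qed
  have st: "s + 1 < t" using t(1) n_ge_2 by simp
  show ?thesis
  proof (rule that[of t "ereal (s + 1)"])
    show "0 < t" using s0 st by simp
    show "ereal (s + 1) < ereal t" using st by simp
    show "1 < real n powr - t * n\<^sup>2 * p" using t(2) n_pos by (simp add: powr_minus_divide pos_less_divide_eq)
    show "AE \<omega> in P. \<forall>k. hausdorff_dim (double_points n (coins \<omega>) k) \<le> ereal (s + 1) - 1"
      using AE_hausdorff_dim_double_points[OF s0] s(1) by (simp add: one_ereal_def)
  qed
qed

theorem corollary6p18:
  fixes P :: "'w measure" and p :: real and n :: nat
    and keep :: "nat \<times> nat \<times> nat \<Rightarrow> 'w \<Rightarrow> bool"
    and M :: "'w \<Rightarrow> (real \<times> real) set"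
  assumes "0 < p" and "p < 1" and "2 \<le> n"
    and "percolation_process P p n keep"
    and "\<And>\<omega>. M \<omega> = percolation_limit n (\<lambda>c. keep c \<omega>)"
  shows "AE \<omega> in P. topological_hausdorff_dim (M \<omega>) < hausdorff_dim (M \<omega>) \<or> M \<omega> = {}"
proof -
  interpret prob_space P using assms(4) by (simp add: percolation_process_def)
  interpret percolation P p n keep
    using assms(3,4) by unfold_locales (auto simp: percolation_process_def)
  have empty: "M \<omega> = {}" if "\<exists>k. kept_squares n (coins \<omega>) k = {}" for \<omega>
    using that percolation_limit_empty[OF n_pos] assms(5) by blast
  show ?thesis
  proof (cases "real (n\<^sup>2) * p \<le> 1")
    case True
    from AE_extinct[OF assms(1) this] show ?thesis
      by eventually_elim (simp add: empty)
  next
    case False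
    then have "1 < real (n\<^sup>2) * p" by simp
    then obtain t d where t: "0 < t" "1 < real n powr - t * n\<^sup>2 * p" "d < ereal t"
      and d: "AE \<omega> in P. \<forall>k. hausdorff_dim (double_points n (coins \<omega>) k) \<le> d - 1"
      by (rule AE_dims[OF assms(1,2)])
    have "real n powr - t < 1"
      using powr_less_mono[of "- t" 0 "real n"] t(1) n_ge_2 by simp
    then have "AE \<omega> in P. positive_cut n (real n powr - t) (coins \<omega>) \<or> (\<exists>k. kept_squares n (coins \<omega>) k = {})"
      using t(2) n_pos by (intro AE_positive_cut) auto
    with d show ?thesis
    proof eventually_elim
      case (elim \<omega>)
      show ?case
      proof (cases "M \<omega> = {}")
        case False
        \<comment> \<open>A nonempty limit set rules out extinction. The lower bound
          \<open>1 / Suc m\<close> may depend on the outcome.\<close>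
        then obtain m where "\<And>l. 1 / real (Suc m) \<le> cut_value n (real n powr - t) l (coins \<omega>)"
          using elim(2) empty by (auto simp: positive_cut_def)
        then have "ereal t \<le> hausdorff_dim (M \<omega>)"
          unfolding assms(5) using False assms(5) n_ge_2
          by (intro hausdorff_dim_ge[where \<epsilon> = "1 / real (Suc m)"]) auto
        moreover have "topological_hausdorff_dim (M \<omega>) \<le> d"
          unfolding assms(5) using False assms(5) n_ge_2 elim(1)
          by (intro topological_hausdorff_dim_le) auto
        ultimately show ?thesis using t(3) by auto
      qed simp
    qed
  qed
qed

end
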